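(* Let $f\in C^2([0,1])$ satisfy $f(0)=f(1)=0$, $0<f(s)\le f'(0)s$ for all $s\in(0,1)$, and suppose $s\mapsto f(s)/s$ is nonincreasing on $(0,1]$; extend $f$ linearly to $\mathbb{R}\setminus[0,1]$. Let $\lambda_*=\sqrt{f'(0)}$, fix $\lambda\in(0,\lambda_* )$, set $c=\lambda+f'(0)/\lambda$, and let $U_c$ be a traveling front profile of speed $c$. Let $u_0:\mathbb{R}\to[0,1]$ be continuous and not identically zero, and suppose there exist $\nu\in\mathbb{R}$ and $a>0$ such that $u_0(x)=ax^{\nu}e^{-\lambda x}$ for all sufficiently large $x$. Let $u$ be the solution of $u_t=u_{xx}+f(u)$, $t>0$, $x\in\mathbb{R}$, with $u(0,\cdot)=u_0$. Then there exists $\sigma_\infty\in\mathbb{R}$ (depending on $u_0$) such that $\lim_{t\to+\infty}\sup_{x\ge0}\big|u(t,x)-U_c\big(x-ct-\frac{\nu}{\lambda}\ln t-\sigma_\infty\big)\big|=0.$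
   Context: "Extended linearly" means $f$ is extended to $\mathbb{R}$ by affine functions outside $[0,1]$. A traveling front of speed $c$ is a decreasing function $U_c:\mathbb{R}\to(0,1)$ with $U_c''+cU_c'+f(U_c)=0$, $U_c(-\infty)=1$, $U_c(+\infty)=0$; for $c\ge 2\sqrt{f'(0)}$ such fronts exist and are unique up to translation; $U_c$ denotes a fixed one. *)

theory Defs
  imports "HOL-Analysis.Analysis"
begin

definition kpp_nonlinearity :: "(real \<Rightarrow> real) \<Rightarrow> (real \<Rightarrow> real) \<Rightarrow> bool" where
  "kpp_nonlinearity f fD \<longleftrightarrow>
     (\<forall>s. (f has_real_derivative fD s) (at s)) \<and>
     (\<exists>fDD. (\<forall>s\<in>{0..1}. (fD has_real_derivative fDD s) (at s within {0..1}))
            \<and> continuous_on {0..1} fDD) \<and>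
     f 0 = 0 \<and> f 1 = 0 \<and>
     (\<forall>s\<in>{0<..<1}. 0 < f s \<and> f s \<le> fD 0 * s) \<and>
     (\<forall>s t. 0 < s \<and> s \<le> t \<and> t \<le> 1 \<longrightarrow> f t / t \<le> f s / s) \<and>
     (\<forall>s\<le>0. f s = fD 0 * s) \<and>
     (\<forall>s\<ge>1. f s = fD 1 * (s - 1))"

definition traveling_front :: "(real \<Rightarrow> real) \<Rightarrow> real \<Rightarrow> (real \<Rightarrow> real) \<Rightarrow> bool" where
  "traveling_front f c U \<longleftrightarrow>
     (\<exists>U' U''. (\<forall>x. (U has_real_derivative U' x) (at x)) \<and>
               (\<forall>x. (U' has_real_derivative U'' x) (at x)) \<and>
               (\<forall>x. U'' x + c * U' x + f (U x) = 0)) \<and>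
     (\<forall>x y. x < y \<longrightarrow> U y < U x) \<and>
     (\<forall>x. 0 < U x \<and> U x < 1) \<and>
     (U \<longlongrightarrow> 1) at_bot \<and> (U \<longlongrightarrow> 0) at_top"

definition classical_solution ::
  "(real \<Rightarrow> real) \<Rightarrow> (real \<Rightarrow> real) \<Rightarrow> (real \<Rightarrow> real \<Rightarrow> real) \<Rightarrow> bool" where
  "classical_solution f u0 u \<longleftrightarrow>
     continuous_on ({0..} \<times> UNIV) (\<lambda>(t,x). u t x) \<and>
     bounded ((\<lambda>(t,x). u t x) ` ({0..} \<times> UNIV)) \<and>
     (\<forall>x. u 0 x = u0 x) \<and>
     (\<exists>ut ux uxx.
        (\<forall>t>0. \<forall>x. ((\<lambda>s. u s x) has_real_derivative ut t x) (at t)) \<and>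
        (\<forall>t>0. \<forall>x. ((\<lambda>y. u t y) has_real_derivative ux t x) (at x)) \<and>
        (\<forall>t>0. \<forall>x. ((\<lambda>y. ux t y) has_real_derivative uxx t x) (at x)) \<and>
        continuous_on ({0<..} \<times> UNIV) (\<lambda>(t,x). ut t x) \<and>
        continuous_on ({0<..} \<times> UNIV) (\<lambda>(t,x). ux t x) \<and>
        continuous_on ({0<..} \<times> UNIV) (\<lambda>(t,x). uxx t x) \<and>
        (\<forall>t>0. \<forall>x. ut t x = uxx t x + f (u t x)))"

end

theory Submission
  imports Defs "HOL-Real_Asymp.Real_Asymp"
begin

text \<open>
  The front satisfies \<open>U z \<sim> A exp (- lam z)\<close> and \<open>- U' / U \<le> lam\<close>. Fix a final time \<open>t\<close> and compare \<open>u\<close>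
  on \<open>[0, t]\<close> with the exact travelling wave \<open>V(s, x) = U(x - c s - S t)\<close>,
  \<open>S t = (nu / lam) ln t + sig\<close>. Because \<open>f s / s\<close> is nonincreasing, \<open>\<bar>u / V - 1\<bar>\<close> is a subsolution of a
  linear drift-diffusion equation without zeroth-order term, whose drift in the frame of the wave
  points backwards with speed at least \<open>del = c - 2 lam > 0\<close> and equal to \<open>del\<close> in the far tail. What is
  seen near the front at time \<open>t\<close> therefore comes from \<open>x \<approx> del t\<close> at time \<open>0\<close>, where
  \<open>u0 / V \<approx> (x / (del t)) powr nu \<approx> 1\<close> for the right \<open>sig\<close>; the other places contribute only
  exponentially small terms. This gives convergence for \<open>x - c t - S t \<ge> - \<kappa> t\<close>. Behind, the wave leaves
  \<open>u \<ge> 1 / 4\<close> in its wake; a small cosine bump makes a positive lower bound persist, a heat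
  subsolution spreads it to the left, and a rising paraboloid lifts it to \<open>1 - \<epsilon>\<close>.
\<close>

section \<open>Maximum principles\<close>

text \<open>A positive \<open>h2\<close> would make \<open>h'\<close>, which vanishes at the
  maximum, positive just to the right of \<open>x\<close>; by the mean value theorem
  \<open>h\<close> would then exceed its maximum.\<close>

lemma interior_max_second_derivative_nonpos:
  fixes h h' :: "real \<Rightarrow> real"
  assumes x: "l < x" "x < r"
    and max: "\<And>y. l < y \<Longrightarrow> y < r \<Longrightarrow> h y \<le> h x"
    and d1: "\<And>y. l < y \<Longrightarrow> y < r \<Longrightarrow> (h has_real_derivative h' y) (at y)"
    and d2: "(h' has_real_derivative h2) (at x)"
  shows "h2 \<le> 0"
proof (rule ccontr)
  assume "\<not> h2 \<le> 0"
  then have pos: "0 < h2" by simp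
  have 0: "h' x = 0"
    by (rule DERIV_local_max[OF d1[OF x], of "min (x - l) (r - x)"])
       (use x max in \<open>auto simp: abs_if split: if_splits\<close>)
  from DERIV_pos_inc_right[OF d2 pos] obtain e where e: "e > 0"
    "\<And>k. 0 < k \<Longrightarrow> k < e \<Longrightarrow> 0 < h' (x + k)" using 0 by auto
  define k where "k = min (e / 2) ((r - x) / 2)"
  have k: "0 < k" "k < e" "x + k < r" using e(1) x by (auto simp: k_def min_def field_simps)
  have "\<exists>z. x < z \<and> z < x + k \<and> h (x + k) - h x = (x + k - x) * h' z"
    by (rule MVT2) (use k x d1 in auto)
  then obtain z where z: "x < z" "z < x + k" "h (x + k) - h x = k * h' z" by auto
  have "h' z > 0" using e(2)[of "z - x"] z k by simp
  then have "h (x + k) > h x" using z k by (smt (verit) mult_pos_pos)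
  with max[of "x + k"] k x show False by auto
qed

text \<open>Pointwise form of \<open>d_t <= d_xx + K d\<close>. It is stated for a single point so
  that it can be demanded only where \<open>d\<close> is positive.\<close>

definition heat_subsolution_at ::
  "real set \<Rightarrow> real \<Rightarrow> (real \<Rightarrow> real \<Rightarrow> real) \<Rightarrow> real \<Rightarrow> real \<Rightarrow> bool" where
  "heat_subsolution_at I K d t x \<longleftrightarrow>
     (\<exists>dt dx dxx. ((\<lambda>s. d s x) has_real_derivative dt) (at t) \<and>
        (\<forall>y\<in>I. ((\<lambda>y. d t y) has_real_derivative dx y) (at y)) \<and>
        (dx has_real_derivative dxx) (at x) \<and> dt \<le> dxx + K * d t x)"

text \<open>The factor \<open>exp (- K * t)\<close> removes the zeroth-order term and subtracting
  \<open>e * (1 + (t - t0))\<close> makes the inequality strict. At a positive maximum the time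
  derivative is then negative, so slightly earlier values are larger. The differential inequality is
  needed only where \<open>d\<close> is positive, which the nonlinear comparisons exploit.\<close>

lemma max_principle_rectangle:
  fixes d :: "real \<Rightarrow> real \<Rightarrow> real"
  assumes cont: "continuous_on ({t0..T} \<times> {l..r}) (\<lambda>(t,x). d t x)"
    and init: "\<And>x. l \<le> x \<Longrightarrow> x \<le> r \<Longrightarrow> d t0 x \<le> 0"
    and left: "\<And>t. t0 \<le> t \<Longrightarrow> t \<le> T \<Longrightarrow> d t l \<le> 0"
    and right: "\<And>t. t0 \<le> t \<Longrightarrow> t \<le> T \<Longrightarrow> d t r \<le> 0"
    and sub: "\<And>t x. t0 < t \<Longrightarrow> t \<le> T \<Longrightarrow> l < x \<Longrightarrow> x < r \<Longrightarrow> 0 < d t x \<Longrightarrow>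
        heat_subsolution_at {l<..<r} K d t x"
    and tx: "t0 \<le> t" "t \<le> T" "l \<le> x" "x \<le> r"
  shows "d t x \<le> 0"
proof (rule ccontr)
  assume "\<not> d t x \<le> 0"
  then have pos: "0 < d t x" by simp
  \<comment> \<open>This \<open>e\<close> leaves half of the presumed positive value at
    \<open>(t, x)\<close>, so \<open>h\<close> has a positive maximum.\<close>
  define e where "e = exp (- K * t) * d t x / 2 / (1 + (t - t0))"
  have e: "0 < e" "e * (1 + (t - t0)) < exp (- K * t) * d t x"
  proof -
    have "0 < exp (- K * t) * d t x" using pos by simp
    moreover have "e * (1 + (t - t0)) = exp (- K * t) * d t x / 2"
    proof -
      have "1 + (t - t0) \<noteq> 0" using tx by simp
      then show ?thesis unfolding e_def by (rule nonzero_eq_divide_eq[THEN iffD1, OF _ refl])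
    qed
    ultimately show "e * (1 + (t - t0)) < exp (- K * t) * d t x" by linarith
  qed (use pos tx in \<open>simp add: e_def\<close>)
  define h where "h = (\<lambda>t x. exp (- K * t) * d t x - e * (1 + (t - t0)))"
  have "continuous_on ({t0..T} \<times> {l..r}) (\<lambda>z. exp (- K * fst z) * (case z of (t,x) \<Rightarrow> d t x) - e * (1 + (fst z - t0)))"
    by (intro continuous_intros cont)
  then have hc: "continuous_on ({t0..T} \<times> {l..r}) (\<lambda>(t,x). h t x)"
    by (simp add: h_def case_prod_unfold)
  have "\<exists>z\<in>{t0..T} \<times> {l..r}. \<forall>y\<in>{t0..T} \<times> {l..r}. (\<lambda>(t,x). h t x) y \<le> (\<lambda>(t,x). h t x) z"
    by (rule continuous_attains_sup[OF _ _ hc]) (use tx in \<open>auto intro: compact_Times\<close>)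
  then obtain t1 x1 where m: "t0 \<le> t1" "t1 \<le> T" "l \<le> x1" "x1 \<le> r"
    "\<And>s y. t0 \<le> s \<Longrightarrow> s \<le> T \<Longrightarrow> l \<le> y \<Longrightarrow> y \<le> r \<Longrightarrow> h s y \<le> h t1 x1" by auto
  have "0 < h t x" using e by (simp add: h_def)
  with m(5)[of t x] tx have "0 < h t1 x1" by simp
  moreover have "0 \<le> e * (1 + (t1 - t0))" using e m by simp
  ultimately have "0 < exp (- K * t1) * d t1 x1" by (simp add: h_def)
  then have dpos: "0 < d t1 x1" by (simp add: zero_less_mult_iff)
  have "t1 \<noteq> t0" using init[OF m(3,4)] dpos by auto
  moreover have "x1 \<noteq> l" "x1 \<noteq> r" using left[OF m(1,2)] right[OF m(1,2)] dpos by auto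
  ultimately have i: "t0 < t1" "l < x1" "x1 < r" using m by auto
  from sub[OF i(1) m(2) i(2,3) dpos] obtain dt dx dxx where D:
    "((\<lambda>s. d s x1) has_real_derivative dt) (at t1)"
    "\<forall>y\<in>{l<..<r}. ((\<lambda>y. d t1 y) has_real_derivative dx y) (at y)"
    "(dx has_real_derivative dxx) (at x1)" "dt \<le> dxx + K * d t1 x1"
    unfolding heat_subsolution_at_def by blast
  have "exp (- K * t1) * dxx \<le> 0"
  proof (rule interior_max_second_derivative_nonpos[OF i(2,3)])
    show "h t1 y \<le> h t1 x1" if "l < y" "y < r" for y using that m by auto
    show "((\<lambda>y. h t1 y) has_real_derivative exp (- K * t1) * dx y) (at y)" if "l < y" "y < r" for y
      unfolding h_def using that by (auto intro!: derivative_eq_intros D(2)[rule_format])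
    show "((\<lambda>y. exp (- K * t1) * dx y) has_real_derivative exp (- K * t1) * dxx) (at x1)"
      by (auto intro!: derivative_eq_intros D(3))
  qed
  then have dxx: "dxx \<le> 0" by (simp add: mult_le_0_iff)
  define ht where "ht = exp (- K * t1) * (dt - K * d t1 x1) - e"
  have ht: "((\<lambda>s. h s x1) has_real_derivative ht) (at t1)"
    unfolding h_def ht_def by (auto intro!: derivative_eq_intros D(1) simp: algebra_simps)
  have "exp (- K * t1) * (dt - K * d t1 x1) \<le> 0"
    using D(4) dxx by (intro mult_nonneg_nonpos) auto
  then have "ht < 0" using e(1) by (simp add: ht_def)
  \<comment> \<open>Only earlier times are compared, so a maximum at the final time \<open>T\<close>
    is covered.\<close>
  from DERIV_neg_dec_left[OF ht this] obtain k where k: "k > 0"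
    "\<And>j. 0 < j \<Longrightarrow> j < k \<Longrightarrow> h t1 x1 < h (t1 - j) x1" by auto
  define j where "j = min (k/2) (t1 - t0)"
  have j: "0 < j" "j < k" "t0 \<le> t1 - j" using k i by (auto simp: j_def min_def field_simps)
  have "h (t1 - j) x1 \<le> h t1 x1" by (rule m(5)) (use j m in auto)
  with k(2)[OF j(1,2)] show False by simp
qed

text \<open>The penalty \<open>e * exp (K * t) * (1 + x^2 + 3 * t)\<close> is a strict
  supersolution, because the rate 3 exceeds the second derivative 2 of \<open>x^2\<close>. It
  outweighs the bound \<open>B\<close> at distance \<open>R\<close>, which reduces the claim to a
  rectangle.\<close>

lemma max_principle_strip:
  fixes d :: "real \<Rightarrow> real \<Rightarrow> real"
  assumes cont: "continuous_on ({0..T} \<times> UNIV) (\<lambda>(t,x). d t x)"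
    and bd: "\<And>t x. 0 \<le> t \<Longrightarrow> t \<le> T \<Longrightarrow> d t x \<le> B"
    and init: "\<And>x. d 0 x \<le> 0"
    and sub: "\<And>t x. 0 < t \<Longrightarrow> t \<le> T \<Longrightarrow> 0 < d t x \<Longrightarrow> heat_subsolution_at UNIV K d t x"
    and t: "0 \<le> t" "t \<le> T"
  shows "d t x \<le> 0"
proof (rule field_le_epsilon)
  fix \<epsilon> :: real assume "\<epsilon> > 0"
  \<comment> \<open>With this choice the penalty at the point in question is exactly
    \<open>\<epsilon>\<close>.\<close>
  define e where "e = \<epsilon> / (exp (K * t) * (1 + x\<^sup>2 + 3 * t))"
  have pos: "0 < 1 + x\<^sup>2 + 3 * t" using t by (smt (verit) zero_le_power2)
  have e: "e > 0" using \<open>\<epsilon> > 0\<close> pos by (simp add: e_def)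
  \<comment> \<open>A lower bound for \<open>exp (K * s)\<close> on the time interval that also
    works for negative \<open>K\<close>.\<close>
  define L where "L = exp (- \<bar>K\<bar> * T)"
  have L: "L > 0" "\<And>s. 0 \<le> s \<Longrightarrow> s \<le> T \<Longrightarrow> L \<le> exp (K * s)"
  proof -
    fix s assume s: "0 \<le> s" "s \<le> T"
    have "- K * s \<le> \<bar>K\<bar> * s" using s by (intro mult_right_mono) auto
    also have "\<dots> \<le> \<bar>K\<bar> * T" using s by (intro mult_left_mono) auto
    finally show "L \<le> exp (K * s)" by (simp add: L_def)
  qed (simp add: L_def)
  define R where "R = max (\<bar>x\<bar> + 1) (\<bar>B\<bar> / (e * L) + 1)"
  have R: "\<bar>x\<bar> \<le> R" "1 \<le> R" "\<bar>B\<bar> / (e * L) \<le> R"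
    using e L(1) by (auto simp: R_def le_max_iff_disj)
  define w where "w = (\<lambda>t x. d t x - e * exp (K * t) * (1 + x\<^sup>2 + 3 * t))"
  have far: "w s y \<le> 0" if "0 \<le> s" "s \<le> T" "y\<^sup>2 = R\<^sup>2" for s y
  proof -
    have "R * 1 \<le> R * R" using R(2) by (intro mult_left_mono) auto
    then have "\<bar>B\<bar> / (e * L) \<le> R\<^sup>2" using R(3) by (simp add: power2_eq_square)
    then have "\<bar>B\<bar> \<le> e * L * R\<^sup>2" using e L(1) by (simp add: field_simps)
    also have "\<dots> \<le> e * exp (K * s) * R\<^sup>2"
      using L(2)[OF that(1,2)] e by (intro mult_right_mono mult_left_mono) auto
    also have "\<dots> \<le> e * exp (K * s) * (1 + y\<^sup>2 + 3 * s)"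
      using that e by (intro mult_left_mono) auto
    finally show ?thesis using bd[OF that(1,2), of y] by (simp add: w_def)
  qed
  have nn: "0 \<le> e * exp (K * s) * (1 + y\<^sup>2 + 3 * s)" if "0 \<le> s" for s y
    using e that by simp
  have "w t x \<le> 0"
  proof (rule max_principle_rectangle[where d = w and l = "- R" and r = R and ?t0.0 = 0 and T = T and K = K])
    have "continuous_on ({0..T} \<times> {-R..R}) (\<lambda>(t,x). d t x)"
      by (rule continuous_on_subset[OF cont]) auto
    then have "continuous_on ({0..T} \<times> {-R..R}) (\<lambda>z. (case z of (t,x) \<Rightarrow> d t x) - e * exp (K * fst z) * (1 + (snd z)\<^sup>2 + 3 * fst z))"
      by (intro continuous_intros)
    then show "continuous_on ({0..T} \<times> {-R..R}) (\<lambda>(t,x). w t x)"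
      by (simp add: w_def case_prod_unfold)
    show "w 0 y \<le> 0" for y using init[of y] nn[of 0 y] by (simp add: w_def)
    show "w s (- R) \<le> 0" "w s R \<le> 0" if "0 \<le> s" "s \<le> T" for s
      using far[OF that] by auto
    fix s y assume s: "0 < s" "s \<le> T" and w: "0 < w s y"
    have "0 < d s y" using w nn[of s y] s by (simp add: w_def)
    from sub[OF s this] obtain dt dx dxx where D:
      "((\<lambda>s. d s y) has_real_derivative dt) (at s)"
      "\<And>y. ((\<lambda>y. d s y) has_real_derivative dx y) (at y)"
      "(dx has_real_derivative dxx) (at y)" "dt \<le> dxx + K * d s y"
      unfolding heat_subsolution_at_def by auto
    define E where "E = e * exp (K * s)"
    show "heat_subsolution_at {- R<..<R} K w s y"
      unfolding heat_subsolution_at_def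
    proof (intro exI conjI ballI)
      show "((\<lambda>s. w s y) has_real_derivative dt - E * (K * (1 + y\<^sup>2 + 3 * s) + 3)) (at s)"
        unfolding w_def E_def by (auto intro!: derivative_eq_intros D(1) simp: algebra_simps)
      show "((\<lambda>y. w s y) has_real_derivative dx y - E * (2 * y)) (at y)" for y
        unfolding w_def E_def by (auto intro!: derivative_eq_intros D(2) simp: algebra_simps)
      show "((\<lambda>y. dx y - E * (2 * y)) has_real_derivative dxx - E * 2) (at y)"
        by (auto intro!: derivative_eq_intros D(3))
      have "E > 0" using e by (simp add: E_def)
      have "K * w s y = K * d s y - E * (K * (1 + y\<^sup>2 + 3 * s))"
        by (simp add: w_def E_def algebra_simps)
      then show "dt - E * (K * (1 + y\<^sup>2 + 3 * s) + 3) \<le> dxx - E * 2 + K * w s y"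
        using D(4) \<open>E > 0\<close> by (simp add: distrib_left)
    qed
  qed (use t R in auto)
  then show "d t x \<le> 0 + \<epsilon>"
    using pos e by (simp add: w_def e_def)
qed

section \<open>The exponential tail of the front\<close>

locale kpp =
  fixes f fD :: "real \<Rightarrow> real"
  assumes kpp: "kpp_nonlinearity f fD"
begin

lemma f_zero: "f 0 = 0" and f_one: "f 1 = 0"
  and f_below: "s \<le> 0 \<Longrightarrow> f s = fD 0 * s"
  and f_above: "1 \<le> s \<Longrightarrow> f s = fD 1 * (s - 1)"
  and f_deriv: "(f has_real_derivative fD s) (at s)"
  and f_pos: "0 < s \<Longrightarrow> s < 1 \<Longrightarrow> 0 < f s"
  using kpp unfolding kpp_nonlinearity_def by auto

lemma fD_zero_pos: "0 < fD 0"
proof -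
  have "0 < f (1/2) \<and> f (1/2) \<le> fD 0 * (1/2)"
    by (rule bspec[of "{0<..<1}"]) (use kpp in \<open>auto simp: kpp_nonlinearity_def\<close>)
  then show ?thesis by simp
qed

lemma f_nonneg: "0 \<le> s \<Longrightarrow> s \<le> 1 \<Longrightarrow> 0 \<le> f s"
  using f_pos[of s] f_zero f_one by (cases "s = 0 \<or> s = 1") (auto simp: less_le)

lemma f_le_linear: "0 \<le> s \<Longrightarrow> s \<le> 1 \<Longrightarrow> f s \<le> fD 0 * s"
proof -
  assume s: "0 \<le> s" "s \<le> 1"
  then consider "s = 0" | "s = 1" | "s \<in> {0<..<1}" by force
  then show ?thesis
  proof cases
    case 3 then show ?thesis using kpp unfolding kpp_nonlinearity_def by blast
  qed (use f_zero f_one fD_zero_pos in auto)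
qed

lemma f_cross_le:
  assumes "0 < s" "s \<le> t" "t \<le> 1"
  shows "f t * s \<le> f s * t"
proof -
  have "f t / t \<le> f s / s" using kpp assms unfolding kpp_nonlinearity_def by blast
  then show ?thesis using assms by (simp add: field_simps)
qed

text \<open>Monotonicity of \<open>f s / s\<close> bounds \<open>f v - f w\<close> by
  \<open>(f w / w) * (v - w)\<close>, and \<open>f w / w\<close> is at most \<open>fD 0\<close>.
  This constant serves as \<open>K\<close> in the comparisons.\<close>

lemma f_one_sided_lipschitz:
  assumes "0 \<le> w" "w \<le> v" "v \<le> 1"
  shows "f v - f w \<le> fD 0 * (v - w)"
proof (cases "w = 0")
  case True
  then show ?thesis using f_le_linear[of v] f_zero assms by simp
next
  case False
  then have w: "0 < w" using assms by simp
  have "(f v - f w) * w \<le> f w * (v - w)"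
    using f_cross_le[OF w assms(2,3)] by (simp add: algebra_simps)
  also have "\<dots> \<le> (fD 0 * w) * (v - w)"
    using f_le_linear[of w] assms by (intro mult_right_mono) auto
  finally have "(f v - f w) * w \<le> (fD 0 * (v - w)) * w" by (simp add: algebra_simps)
  then show ?thesis using w by simp
qed

text \<open>The second derivative is bounded on the compact interval, so \<open>fD\<close> differs
  from \<open>fD 0\<close> by at most \<open>M * z\<close>, and the mean value theorem turns this
  into a quadratic defect.\<close>

lemma f_quadratic_lower:
  obtains M where "0 \<le> M" "\<And>s. 0 \<le> s \<Longrightarrow> s \<le> 1 \<Longrightarrow> fD 0 * s - M * s\<^sup>2 \<le> f s"
proof -
  obtain fDD where D: "\<And>s. s \<in> {0..1} \<Longrightarrow> (fD has_real_derivative fDD s) (at s within {0..1})"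
    "continuous_on {0..1} fDD"
    using kpp unfolding kpp_nonlinearity_def by blast
  have "bounded (fDD ` {0..1})"
    by (intro compact_imp_bounded compact_continuous_image D) auto
  then obtain M where M: "\<And>s. s \<in> {0..1} \<Longrightarrow> norm (fDD s) \<le> M"
    unfolding bounded_iff by blast
  have M0: "0 \<le> M" using M[of 0] norm_ge_zero[of "fDD 0"] by simp
  have "fD 0 * s - M * s\<^sup>2 \<le> f s" if s: "0 \<le> s" "s \<le> 1" for s
  proof (cases "s = 0")
    case False
    with s have "0 < s" by simp
    have "\<exists>z. 0 < z \<and> z < s \<and> f s - f 0 = (s - 0) * fD z"
      by (rule MVT2[OF \<open>0 < s\<close>]) (use f_deriv in auto)
    then obtain z where z: "0 < z" "z < s" "f s = s * fD z" using f_zero by auto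
    have "norm (fD z - fD 0) \<le> M * norm (z - 0)"
      by (rule field_differentiable_bound[OF _ D(1) M]) (use z s in auto)
    then have "fD 0 - M * z \<le> fD z" using z by auto
    moreover have "M * z \<le> M * s" using z M0 by (intro mult_left_mono) auto
    ultimately have "fD 0 - M * s \<le> fD z" by simp
    then have "s * (fD 0 - M * s) \<le> s * fD z" using \<open>0 < s\<close> by (intro mult_left_mono) auto
    then show ?thesis using z by (simp add: algebra_simps power2_eq_square)
  qed (simp add: f_zero)
  with M0 show ?thesis by (rule that)
qed

end

lemma exp_neg_linear_tendsto_0: "0 < k \<Longrightarrow> ((\<lambda>x::real. exp (- k * x)) \<longlongrightarrow> 0) at_top"
  by real_asymp

section \<open>Decay rate and asymptotics of the front\<close>

locale kpp_front = kpp +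
  fixes U :: "real \<Rightarrow> real" and lam c :: real
  assumes lam_pos: "0 < lam" and lam_less: "lam < sqrt (fD 0)"
    and c_eq: "c = lam + fD 0 / lam"
    and front: "traveling_front f c U"
begin

definition mu :: real where "mu = fD 0 / lam"
definition del :: real where "del = mu - lam"

lemma lam_mu: "lam * mu = fD 0" and c_mu: "c = lam + mu" and c_del: "c = 2 * lam + del"
  using lam_pos c_eq by (auto simp: mu_def del_def)

lemma del_pos: "0 < del"
proof -
  have "lam\<^sup>2 < (sqrt (fD 0))\<^sup>2" using lam_pos lam_less by (intro power_strict_mono) auto
  then have "lam * lam < fD 0" using fD_zero_pos by (simp add: power2_eq_square)
  then show ?thesis using lam_pos by (simp add: del_def mu_def field_simps)
qed

lemma mu_pos: "0 < mu"
  using del_pos lam_pos by (simp add: del_def)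

lemma U_pos: "0 < U x" and U_less_1: "U x < 1"
  and U_strict: "x < y \<Longrightarrow> U y < U x"
  and U_at_bot: "(U \<longlongrightarrow> 1) at_bot" and U_at_top: "(U \<longlongrightarrow> 0) at_top"
  using front unfolding traveling_front_def by auto

lemma U_antimono: "x \<le> y \<Longrightarrow> U y \<le> U x"
  using U_strict[of x y] by (cases "x = y") auto

lemma U_deriv: "(U has_real_derivative deriv U x) (at x)"
  and U_deriv2: "(deriv U has_real_derivative - (c * deriv U x + f (U x))) (at x)"
proof -
  obtain U' U'' where D: "\<And>x. (U has_real_derivative U' x) (at x)"
    "\<And>x. (U' has_real_derivative U'' x) (at x)" "\<And>x. U'' x + c * U' x + f (U x) = 0"
    using front unfolding traveling_front_def by blast
  have eq: "deriv U = U'" using D(1) DERIV_imp_deriv by blast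
  have "U'' x = - (c * U' x + f (U x))" using D(3)[of x] by simp
  then show "(U has_real_derivative deriv U x) (at x)"
    "(deriv U has_real_derivative - (c * deriv U x + f (U x))) (at x)"
    using D(1,2)[of x] by (simp_all add: eq)
qed

lemma U_deriv_nonpos: "deriv U x \<le> 0"
proof (rule ccontr)
  assume "\<not> deriv U x \<le> 0"
  with DERIV_pos_inc_right[OF U_deriv, of x] obtain e where "e > 0"
    "\<And>h. 0 < h \<Longrightarrow> h < e \<Longrightarrow> U x < U (x + h)" by auto
  from this(1) this(2)[of "e/2"] U_strict[of x "x + e/2"] show False by auto
qed

text \<open>The roots of \<open>p\<^sup>2 - c p + f'(0)\<close> are \<open>lam < mu\<close>; the quotient \<open>tail_slope / U\<close> measures
  how far the logarithmic decay rate \<open>- U' / U\<close> is from the smaller one.\<close>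

definition tail_slope :: "real \<Rightarrow> real" where "tail_slope x = deriv U x + lam * U x"

lemma tail_slope_le: "tail_slope x \<le> lam * U x"
  using U_deriv_nonpos[of x] by (simp add: tail_slope_def)

text \<open>Since the roots have sum \<open>c\<close> and product \<open>fD 0\<close>, the front
  equation factors into a first-order equation with damping \<open>mu\<close> and the nonnegative
  source \<open>fD 0 * U - f U\<close>.\<close>

lemma tail_slope_deriv: "(tail_slope has_real_derivative - mu * tail_slope x + (fD 0 * U x - f (U x))) (at x)"
  unfolding tail_slope_def[abs_def]
  by (auto intro!: derivative_eq_intros U_deriv U_deriv2
      simp: lam_mu[symmetric] c_mu algebra_simps)

lemma exp_tail_slope_mono:
  assumes "x \<le> y"
  shows "exp (mu * x) * tail_slope x \<le> exp (mu * y) * tail_slope y"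
proof (rule DERIV_nonneg_imp_nondecreasing[where f = "\<lambda>x. exp (mu * x) * tail_slope x", OF assms])
  fix z
  have "((\<lambda>x. exp (mu * x) * tail_slope x) has_real_derivative exp (mu * z) * (fD 0 * U z - f (U z))) (at z)"
    by (auto intro!: derivative_eq_intros tail_slope_deriv simp: algebra_simps)
  moreover have "0 \<le> exp (mu * z) * (fD 0 * U z - f (U z))"
    using f_le_linear[of "U z"] U_pos[of z] U_less_1[of z] by simp
  ultimately show "\<exists>y. ((\<lambda>x. exp (mu * x) * tail_slope x) has_real_derivative y) (at z) \<and> 0 \<le> y" by blast
qed

text \<open>A negative value would keep \<open>exp (mu * z) * tail_slope z\<close> below a fixed
  negative number for all smaller \<open>z\<close>. But \<open>U\<close> takes values in
  \<open>(0, 1)\<close>, so every unit interval contains a point with \<open>U' >= - 1\<close>, and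
  far to the left the product there is close to zero or positive.\<close>

lemma tail_slope_nonneg: "0 \<le> tail_slope x"
proof (rule ccontr)
  assume neg: "\<not> 0 \<le> tail_slope x"
  define g where "g = - (exp (mu * x) * tail_slope x)"
  have g: "0 < g" using neg by (simp add: g_def mult_pos_neg)
  define y where "y = min x (ln (g / 2) / mu)"
  have "mu * y \<le> ln (g / 2)" using mu_pos by (simp add: y_def min_def field_simps)
  then have "exp (mu * y) \<le> g / 2" using g by (metis exp_le_cancel_iff exp_ln half_gt_zero)
  have "\<exists>z. y - 1 < z \<and> z < y \<and> U y - U (y - 1) = (y - (y - 1)) * deriv U z"
    by (rule MVT2) (use U_deriv in auto)
  then obtain z where z: "z < y" "U y - U (y - 1) = deriv U z" by auto
  have "- 1 \<le> tail_slope z"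
    using z U_pos[of y] U_less_1[of "y - 1"] U_pos[of z] lam_pos by (auto simp: tail_slope_def add_increasing2)
  then have "- exp (mu * z) \<le> exp (mu * z) * tail_slope z"
    by (smt (verit) exp_gt_zero mult_left_le mult_minus_right mult_left_mono mult_1_right)
  also have "\<dots> \<le> - g" unfolding g_def using exp_tail_slope_mono[of z x] z by (simp add: y_def)
  finally have "g \<le> exp (mu * z)" by simp
  also have "\<dots> \<le> exp (mu * y)" using z mu_pos by simp
  finally show False using \<open>exp (mu * y) \<le> g / 2\<close> g by simp
qed

lemma tail_deriv: "((\<lambda>x. U x * exp (lam * x)) has_real_derivative tail_slope x * exp (lam * x)) (at x)"
  by (auto intro!: derivative_eq_intros U_deriv simp: tail_slope_def algebra_simps)

lemma tail_mono: "x \<le> y \<Longrightarrow> U x * exp (lam * x) \<le> U y * exp (lam * y)"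
  by (rule DERIV_nonneg_imp_nondecreasing[where f = "\<lambda>x. U x * exp (lam * x)"])
     (use tail_deriv tail_slope_nonneg in \<open>force intro: mult_nonneg_nonneg\<close>)+

text \<open>Used where the initial ratio is estimated and the front stands in the denominator: a
  constant bound on the left, an exponential one on the right.\<close>

lemma U_lower: "U 0 \<le> U x \<or> U 0 * exp (- lam * x) \<le> U x"
proof (cases "x \<le> 0")
  case False
  then have "U 0 * exp (- lam * x) \<le> U x * exp (lam * x) * exp (- lam * x)"
    using tail_mono[of 0 x] by (intro mult_right_mono) auto
  then show ?thesis by (simp add: mult.assoc flip: exp_add)
qed (use U_antimono in auto)

text \<open>\<open>B * U powr (1 + th)\<close> is a supersolution of the first-order equation for
  \<open>tail_slope\<close>, so \<open>F\<close> below is nonincreasing. What remains of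
  \<open>F 0\<close> decays like \<open>exp (- mu * x)\<close>, faster than \<open>U\<close> by the
  factor \<open>exp (- del * x)\<close>.\<close>

lemma tail_slope_rate:
  obtains B D th where "0 < th" "0 \<le> B" "0 \<le> D"
    "\<And>x. 0 \<le> x \<Longrightarrow> tail_slope x \<le> U x * (B * U x powr th + D * exp (- del * x))"
proof -
  obtain M where M: "0 \<le> M" "\<And>s. 0 \<le> s \<Longrightarrow> s \<le> 1 \<Longrightarrow> fD 0 * s - M * s\<^sup>2 \<le> f s"
    using f_quadratic_lower by metis
  \<comment> \<open>The exponent keeps \<open>(1 + th) * lam < mu\<close>, which makes the \<open>B\<close>-term absorb the quadratic
    defect \<open>fD 0 * U - f U\<close> in the derivative of \<open>F\<close>.\<close>
  define th where "th = min 1 (del / (2 * lam))"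
  have th: "0 < th" "th \<le> 1" using del_pos lam_pos by (auto simp: th_def)
  have "th * lam \<le> del / 2" using lam_pos by (simp add: th_def min_def field_simps)
  then have gap: "0 < mu - (1 + th) * lam" using del_pos by (simp add: del_def algebra_simps)
  define B where "B = M / (mu - (1 + th) * lam)"
  have B: "0 \<le> B" "B * (mu - (1 + th) * lam) = M" using gap M(1) by (auto simp: B_def)
  define W where "W = (\<lambda>x. U x powr (1 + th))"
  define F where "F = (\<lambda>x. exp (mu * x) * (tail_slope x - B * W x))"
  have mono: "F y \<le> F x" if "x \<le> y" for x y
  proof (rule DERIV_nonpos_imp_nonincreasing[OF that])
    fix z
    define P where "P = U z powr th"
    have P: "W z = U z * P" using U_pos[of z] by (simp add: W_def P_def powr_add)
    have "U z powr 1 \<le> U z powr th"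
      using th U_pos[of z] U_less_1[of z] by (intro powr_mono') auto
    then have UP: "U z \<le> P" using U_pos[of z] by (simp add: P_def)
    define F' where "F' = exp (mu * z) * ((fD 0 * U z - f (U z)) - mu * B * (U z * P) - B * (1 + th) * P * deriv U z)"
    have "((\<lambda>x. U x powr (1 + th)) has_real_derivative (1 + th) * U z powr (1 + th - 1) * deriv U z) (at z)"
      by (rule DERIV_chain2[OF has_real_derivative_powr[OF U_pos] U_deriv])
    then have dP: "(W has_real_derivative (1 + th) * P * deriv U z) (at z)"
      by (simp add: P_def W_def)
    have "(F has_real_derivative F') (at z)"
      unfolding F_def F'_def
      by (auto intro!: derivative_eq_intros dP tail_slope_deriv simp: P algebra_simps)
    moreover have "F' \<le> 0"
    proof -
      have "fD 0 * U z - f (U z) \<le> M * (U z * U z)"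
        using M(2)[of "U z"] U_pos[of z] U_less_1[of z] by (simp add: power2_eq_square)
      also have "\<dots> \<le> M * (U z * P)"
        using UP M(1) U_pos[of z] by (intro mult_left_mono) auto
      finally have 1: "fD 0 * U z - f (U z) \<le> M * (U z * P)" .
      have "- deriv U z \<le> lam * U z" using tail_slope_nonneg[of z] by (simp add: tail_slope_def)
      then have "(B * (1 + th) * P) * (- deriv U z) \<le> (B * (1 + th) * P) * (lam * U z)"
        using B th by (intro mult_left_mono) (auto simp: P_def)
      with 1 have "(fD 0 * U z - f (U z)) - mu * B * (U z * P) - B * (1 + th) * P * deriv U z
          \<le> (M - B * (mu - (1 + th) * lam)) * (U z * P)"
        by (simp add: algebra_simps)
      then show ?thesis by (simp add: F'_def B(2) mult_le_0_iff)
    qed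
    ultimately show "\<exists>y. (F has_real_derivative y) (at z) \<and> y \<le> 0" by blast
  qed
  \<comment> \<open>Dividing by \<open>U 0\<close> is what lets
    \<open>U 0 <= U x * exp (lam * x)\<close> trade the constant for a multiple of the
    front.\<close>
  define D where "D = \<bar>F 0\<bar> / U 0"
  have D: "0 \<le> D" using U_pos[of 0] by (simp add: D_def)
  have "tail_slope x \<le> U x * (B * U x powr th + D * exp (- del * x))" if x: "0 \<le> x" for x
  proof -
    have "F x \<le> D * U 0" using mono[OF x] U_pos[of 0] by (simp add: D_def)
    also have "\<dots> \<le> D * (U x * exp (lam * x))"
      using tail_mono[OF x] D by (intro mult_left_mono) auto
    finally have "F x * exp (- mu * x) \<le> D * (U x * exp (lam * x)) * exp (- mu * x)"
      by (intro mult_right_mono) auto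
    also have "\<dots> = D * U x * exp (- del * x)"
      by (simp add: del_def algebra_simps flip: exp_add)
    also have "F x * exp (- mu * x) = tail_slope x - B * W x"
      by (simp add: F_def exp_minus field_simps)
    also have "W x = U x * U x powr th" using U_pos[of x] by (simp add: W_def powr_add)
    finally show ?thesis by (simp add: algebra_simps)
  qed
  with th(1) B(1) D show ?thesis by (rule that)
qed

text \<open>Says that \<open>U' / U\<close> tends to \<open>- lam\<close>. This starts the decay
  estimate in \<open>front_tail\<close> and supplies the point \<open>Z\<close> of the
  barrier.\<close>

lemma tail_slope_small:
  assumes "0 < e"
  shows "\<forall>\<^sub>F x in at_top. tail_slope x \<le> e * U x"
proof -
  obtain B D th where *: "0 < th" "0 \<le> B" "0 \<le> D"
    "\<And>x. 0 \<le> x \<Longrightarrow> tail_slope x \<le> U x * (B * U x powr th + D * exp (- del * x))"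
    using tail_slope_rate by metis
  have "((\<lambda>x. U x powr th) \<longlongrightarrow> 0) at_top"
    using tendsto_zero_powrI[OF U_at_top, of "\<lambda>_. th" th] *(1) U_pos
    by (auto simp: less_imp_le)
  moreover have "((\<lambda>x. exp (- del * x)) \<longlongrightarrow> 0) at_top"
    by (rule exp_neg_linear_tendsto_0[OF del_pos])
  ultimately have "((\<lambda>x. B * U x powr th + D * exp (- del * x)) \<longlongrightarrow> B * 0 + D * 0) at_top"
    by (intro tendsto_intros)
  then have "\<forall>\<^sub>F x in at_top. B * U x powr th + D * exp (- del * x) < e"
    using assms by (auto dest: order_tendstoD)
  then show ?thesis using eventually_ge_at_top[of 0]
  proof eventually_elim
    case (elim x)
    have "U x * (B * U x powr th + D * exp (- del * x)) \<le> U x * e"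
      using elim U_pos[of x] by (intro mult_left_mono) auto
    with *(4)[of x] elim show ?case by (simp add: mult.commute)
  qed
qed

text \<open>The logarithmic derivative of \<open>U x * exp (lam * x)\<close> is
  \<open>tail_slope / U\<close>. It is nonnegative and bounded by an integrable exponential, so the
  product increases to a finite positive limit.\<close>

lemma front_tail:
  obtains A where "0 < A" "\<And>x. U x * exp (lam * x) \<le> A"
    "((\<lambda>x. U x * exp (lam * x)) \<longlongrightarrow> A) at_top"
proof -
  obtain B D th where R: "0 < th" "0 \<le> B" "0 \<le> D"
    "\<And>x. 0 \<le> x \<Longrightarrow> tail_slope x \<le> U x * (B * U x powr th + D * exp (- del * x))"
    using tail_slope_rate by metis
  \<comment> \<open>First a crude decay at rate \<open>lam / 2\<close>; it converts the power of
    \<open>U\<close> in the rate estimate into an exponential.\<close>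
  obtain Z where Z: "0 \<le> Z" "\<And>x. Z \<le> x \<Longrightarrow> tail_slope x \<le> lam / 2 * U x"
  proof -
    from tail_slope_small[of "lam/2"] lam_pos obtain Z where "\<And>x. Z \<le> x \<Longrightarrow> tail_slope x \<le> lam / 2 * U x"
      by (auto simp: eventually_at_top_linorder)
    then show ?thesis by (intro that[of "max 0 Z"]) auto
  qed
  define C where "C = U Z * exp (lam / 2 * Z)"
  have decay: "U x \<le> C * exp (- (lam / 2) * x)" if "Z \<le> x" for x
  proof -
    have "U x * exp (lam / 2 * x) \<le> U Z * exp (lam / 2 * Z)"
    proof (rule DERIV_nonpos_imp_nonincreasing[where f = "\<lambda>x. U x * exp (lam / 2 * x)", OF that])
      fix z assume "Z \<le> z"
      have "((\<lambda>x. U x * exp (lam / 2 * x)) has_real_derivative (tail_slope z - lam / 2 * U z) * exp (lam / 2 * z)) (at z)"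
        by (auto intro!: derivative_eq_intros U_deriv simp: tail_slope_def algebra_simps)
      moreover have "(tail_slope z - lam / 2 * U z) * exp (lam / 2 * z) \<le> 0"
        using Z(2)[OF \<open>Z \<le> z\<close>] by (simp add: mult_le_0_iff)
      ultimately show "\<exists>y. ((\<lambda>x. U x * exp (lam / 2 * x)) has_real_derivative y) (at z) \<and> y \<le> 0" by blast
    qed
    then have "U x * exp (lam / 2 * x) * exp (- (lam / 2) * x) \<le> C * exp (- (lam / 2) * x)"
      unfolding C_def by (intro mult_right_mono) auto
    then show ?thesis by (simp add: mult.assoc flip: exp_add)
  qed
  have C: "0 < C" using U_pos by (simp add: C_def)
  define k where "k = min (th * lam / 2) del"
  have k: "0 < k" "k \<le> th * lam / 2" "k \<le> del" using R(1) lam_pos del_pos by (auto simp: k_def)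
  define E where "E = B * C powr th + D"
  have E: "0 \<le> E" using R by (simp add: E_def)
  have rE: "tail_slope x \<le> U x * (E * exp (- k * x))" if x: "Z \<le> x" for x
  proof -
    have x0: "0 \<le> x" using x Z by simp
    have "U x powr th \<le> (C * exp (- (lam / 2) * x)) powr th"
      using decay[OF x] R(1) U_pos[of x] by (intro powr_mono2) auto
    also have "\<dots> = C powr th * exp (- (th * lam / 2) * x)"
      using C by (simp add: powr_mult exp_powr_real algebra_simps)
    also have "\<dots> \<le> C powr th * exp (- k * x)"
      using mult_right_mono[OF k(2) x0] by (intro mult_left_mono) auto
    finally have "B * U x powr th \<le> B * (C powr th * exp (- k * x))"
      using R by (intro mult_left_mono) auto
    moreover have "D * exp (- del * x) \<le> D * exp (- k * x)"
      using mult_right_mono[OF k(3) x0] R by (intro mult_left_mono) auto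
    ultimately have "B * U x powr th + D * exp (- del * x) \<le> E * exp (- k * x)"
      by (simp add: E_def algebra_simps)
    then have "U x * (B * U x powr th + D * exp (- del * x)) \<le> U x * (E * exp (- k * x))"
      using U_pos[of x] by (intro mult_left_mono) auto
    with R(4)[OF x0] show ?thesis by simp
  qed
  define y where "y = (\<lambda>x. U x * exp (lam * x))"
  \<comment> \<open>The second factor has logarithmic derivative \<open>- E * exp (- k * x)\<close>,
    which cancels the possible growth of \<open>y\<close> beyond \<open>Z\<close>; it is at least 1,
    so \<open>H\<close> dominates \<open>y\<close>.\<close>
  define H where "H = (\<lambda>x. y x * exp (E / k * exp (- k * x)))"
  have bound: "y x \<le> H Z" for x
  proof -
    define m where "m = max x Z"
    have "H m \<le> H Z"
    proof (rule DERIV_nonpos_imp_nonincreasing[where f = H])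
      fix z assume "Z \<le> z"
      define G where "G = exp (E / k * exp (- k * z))"
      define H' where "H' = (tail_slope z * exp (lam * z) - y z * (E * exp (- k * z))) * G"
      have dy: "(y has_real_derivative tail_slope z * exp (lam * z)) (at z)"
        unfolding y_def by (rule tail_deriv)
      have "(H has_real_derivative H') (at z)"
        unfolding H_def H'_def G_def using k
        by (auto intro!: derivative_eq_intros dy simp: algebra_simps)
      moreover have "H' \<le> 0"
        using mult_right_mono[OF rE[OF \<open>Z \<le> z\<close>], of "exp (lam * z)"]
        by (auto simp: H'_def G_def y_def mult_le_0_iff algebra_simps)
      ultimately show "\<exists>y. (H has_real_derivative y) (at z) \<and> y \<le> 0" by blast
    qed (simp add: m_def)
    have "y x \<le> y m" unfolding y_def by (rule tail_mono) (simp add: m_def)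
    also have "\<dots> * 1 \<le> H m" unfolding H_def
      using E k U_pos[of m] by (intro mult_left_mono) (auto simp: y_def)
    finally show ?thesis using \<open>H m \<le> H Z\<close> by simp
  qed
  define A where "A = (SUP x. y x)"
  have bdd: "bdd_above (range y)" using bound by (auto intro!: bdd_aboveI[of _ "H Z"])
  have le: "y x \<le> A" for x unfolding A_def by (rule cSUP_upper[OF _ bdd]) simp
  have "0 < y 0" using U_pos by (simp add: y_def)
  with le[of 0] have "0 < A" by simp
  moreover have "(y \<longlongrightarrow> A) at_top"
  proof (rule increasing_tendsto)
    fix b assume "b < A"
    then obtain x where "b < y x" unfolding A_def using less_cSUP_iff[OF _ bdd] by auto
    moreover have "y x \<le> y z" if "x \<le> z" for z unfolding y_def using that by (rule tail_mono)
    ultimately show "\<forall>\<^sub>F x in at_top. b < y x"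
      unfolding eventually_at_top_linorder by (meson less_le_trans)
  qed (use le in auto)
  ultimately show ?thesis using le that unfolding y_def by blast
qed

end

section \<open>Solutions of the Cauchy problem\<close>

locale kpp_solution = kpp +
  fixes u0 :: "real \<Rightarrow> real" and u :: "real \<Rightarrow> real \<Rightarrow> real"
  assumes u0_range: "\<And>x. 0 \<le> u0 x" "\<And>x. u0 x \<le> 1"
    and solution: "classical_solution f u0 u"
begin

lemma u_initial: "u 0 x = u0 x"
  using solution unfolding classical_solution_def by auto

lemma u_continuous: "X \<subseteq> {0..} \<times> UNIV \<Longrightarrow> continuous_on X (\<lambda>(t,x). u t x)"
  using solution unfolding classical_solution_def by (blast intro: continuous_on_subset)

lemma u_regular:
  assumes "0 < t"
  obtains ux uxx where "((\<lambda>s. u s x) has_real_derivative uxx + f (u t x)) (at t)"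
    "\<And>y. ((\<lambda>y. u t y) has_real_derivative ux y) (at y)"
    "(ux has_real_derivative uxx) (at x)"
  using solution unfolding classical_solution_def
proof (elim conjE exE)
  fix ut ux uxx
  assume D: "\<forall>t>0. \<forall>x. ((\<lambda>s. u s x) has_real_derivative ut t x) (at t)"
    "\<forall>t>0. \<forall>x. ((\<lambda>y. u t y) has_real_derivative ux t x) (at x)"
    "\<forall>t>0. \<forall>x. ((\<lambda>y. ux t y) has_real_derivative uxx t x) (at x)"
    "\<forall>t>0. \<forall>x. ut t x = uxx t x + f (u t x)"
  show thesis
  proof (rule that)
    show "((\<lambda>s. u s x) has_real_derivative uxx t x + f (u t x)) (at t)"
      using D(1) by (simp add: assms flip: D(4)[rule_format, OF assms])
  qed (use D(2,3) assms in auto)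
qed

text \<open>The equation of \<open>u\<close> eliminates its derivatives, so only the defect of
  \<open>w\<close> and the value \<open>f (u t x)\<close> have to be estimated.\<close>

lemma heat_subsolution_diff_below:
  assumes t: "0 < t"
    and w: "((\<lambda>s. w s x) has_real_derivative wt) (at t)"
      "\<And>y. y \<in> I \<Longrightarrow> ((\<lambda>y. w t y) has_real_derivative wx y) (at y)"
      "(wx has_real_derivative wxx) (at x)"
    and le: "wt - wxx - f (u t x) \<le> K * (w t x - u t x)"
  shows "heat_subsolution_at I K (\<lambda>t x. w t x - u t x) t x"
proof -
  obtain ux uxx where D: "((\<lambda>s. u s x) has_real_derivative uxx + f (u t x)) (at t)"
    "\<And>y. ((\<lambda>y. u t y) has_real_derivative ux y) (at y)" "(ux has_real_derivative uxx) (at x)"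
    using u_regular[OF t, of x] by blast
  have "wt - (uxx + f (u t x)) \<le> (wxx - uxx) + K * (w t x - u t x)" using le by simp
  then show ?thesis unfolding heat_subsolution_at_def
    using DERIV_diff[OF w(1) D(1)] DERIV_diff[OF w(2) D(2)] DERIV_diff[OF w(3) D(3)]
    by (intro exI[of _ "wt - (uxx + f (u t x))"] exI[of _ "\<lambda>y. wx y - ux y"] exI[of _ "wxx - uxx"]) auto
qed

lemma heat_subsolution_diff_above:
  assumes t: "0 < t"
    and w: "((\<lambda>s. w s x) has_real_derivative wt) (at t)"
      "\<And>y. y \<in> I \<Longrightarrow> ((\<lambda>y. w t y) has_real_derivative wx y) (at y)"
      "(wx has_real_derivative wxx) (at x)"
    and le: "f (u t x) - (wt - wxx) \<le> K * (u t x - w t x)"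
  shows "heat_subsolution_at I K (\<lambda>t x. u t x - w t x) t x"
proof -
  obtain ux uxx where D: "((\<lambda>s. u s x) has_real_derivative uxx + f (u t x)) (at t)"
    "\<And>y. ((\<lambda>y. u t y) has_real_derivative ux y) (at y)" "(ux has_real_derivative uxx) (at x)"
    using u_regular[OF t, of x] by blast
  have "(uxx + f (u t x)) - wt \<le> (uxx - wxx) + K * (u t x - w t x)" using le by simp
  then show ?thesis unfolding heat_subsolution_at_def
    using DERIV_diff[OF D(1) w(1)] DERIV_diff[OF D(2) w(2)] DERIV_diff[OF D(3) w(3)]
    by (intro exI[of _ "(uxx + f (u t x)) - wt"] exI[of _ "\<lambda>y. ux y - wx y"] exI[of _ "uxx - wxx"]) auto
qed

text \<open>Outside \<open>[0, 1]\<close> the linear extension of \<open>f\<close> makes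
  \<open>- u\<close> and \<open>u - 1\<close> solve linear equations with \<open>K = fD 0\<close>
  and \<open>K = fD 1\<close>, exactly where they are positive.\<close>

lemma u_range: assumes t: "0 \<le> t" shows "0 \<le> u t x" "u t x \<le> 1"
proof -
  have "bounded ((\<lambda>(t,x). u t x) ` ({0..} \<times> UNIV))"
    using solution unfolding classical_solution_def by auto
  then obtain B where "\<forall>z\<in>(\<lambda>(t,x). u t x) ` ({0..} \<times> UNIV). norm z \<le> B"
    unfolding bounded_iff by blast
  then have B: "\<bar>u s x\<bar> \<le> B" if "0 \<le> s" for s x
    using that by (auto simp: Ball_def image_iff)
  have c: "continuous_on ({0..t} \<times> UNIV) (\<lambda>z. case z of (t,x) \<Rightarrow> u t x)"
    by (rule u_continuous) auto
  have "(\<lambda>s x. 0 - u s x) t x \<le> 0"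
  proof (rule max_principle_strip[where d = "\<lambda>s x. 0 - u s x" and T = t and B = B and K = "fD 0"])
    show "continuous_on ({0..t} \<times> UNIV) (\<lambda>(s,x). 0 - u s x)"
      using continuous_on_diff[OF continuous_on_const[of _ 0] c] by (simp add: case_prod_unfold)
    show "0 - u s y \<le> B" if "0 \<le> s" for s y using B[OF that, of y] by auto
    fix s y assume s: "0 < s" "0 < 0 - u s y"
    show "heat_subsolution_at UNIV (fD 0) (\<lambda>s x. 0 - u s x) s y"
      by (rule heat_subsolution_diff_below[where wt = 0 and wx = "\<lambda>_. 0" and wxx = 0])
         (use s in \<open>auto simp: f_below\<close>)
  qed (use t u0_range in \<open>auto simp: u_initial\<close>)
  then show "0 \<le> u t x" by simp
  have "(\<lambda>s x. u s x - 1) t x \<le> 0"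
  proof (rule max_principle_strip[where d = "\<lambda>s x. u s x - 1" and T = t and B = B and K = "fD 1"])
    show "continuous_on ({0..t} \<times> UNIV) (\<lambda>(s,x). u s x - 1)"
      using continuous_on_diff[OF c continuous_on_const[of _ 1]] by (simp add: case_prod_unfold)
    show "u s y - 1 \<le> B" if "0 \<le> s" for s y using B[OF that, of y] by auto
    fix s y assume s: "0 < s" "0 < u s y - 1"
    show "heat_subsolution_at UNIV (fD 1) (\<lambda>s x. u s x - 1) s y"
      by (rule heat_subsolution_diff_above[where wt = 0 and wx = "\<lambda>_. 0" and wxx = 0])
         (use s in \<open>auto simp: f_above\<close>)
  qed (use t u0_range in \<open>auto simp: u_initial\<close>)
  then show "u t x \<le> 1" by simp
qed

section \<open>Local subsolutions and lower bounds for the solution\<close>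

lemma compare_rectangle:
  assumes t0: "0 \<le> t0"
    and cont: "continuous_on ({t0..T} \<times> {l..r}) (\<lambda>(t,x). w t x)"
    and init: "\<And>x. l \<le> x \<Longrightarrow> x \<le> r \<Longrightarrow> w t0 x \<le> u t0 x"
    and left: "\<And>t. t0 \<le> t \<Longrightarrow> t \<le> T \<Longrightarrow> w t l \<le> u t l"
    and right: "\<And>t. t0 \<le> t \<Longrightarrow> t \<le> T \<Longrightarrow> w t r \<le> u t r"
    and D: "\<And>t x. ((\<lambda>s. w s x) has_real_derivative wt t x) (at t)"
      "\<And>t x. ((\<lambda>y. w t y) has_real_derivative wx t x) (at x)"
      "\<And>t x. ((\<lambda>y. wx t y) has_real_derivative wxx t x) (at x)"
    and sub: "\<And>t x. t0 < t \<Longrightarrow> t \<le> T \<Longrightarrow> l < x \<Longrightarrow> x < r \<Longrightarrow> u t x < w t x \<Longrightarrow>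
      w t x \<le> 1 \<and> wt t x \<le> wxx t x + f (w t x)"
    and tx: "t0 \<le> t" "t \<le> T" "l \<le> x" "x \<le> r"
  shows "w t x \<le> u t x"
proof -
  have "(\<lambda>t x. w t x - u t x) t x \<le> 0"
  proof (rule max_principle_rectangle[where d = "\<lambda>t x. w t x - u t x" and ?t0.0 = t0 and T = T and l = l and r = r and K = "fD 0"])
    have "continuous_on ({t0..T} \<times> {l..r}) (\<lambda>(t,x). u t x)"
      by (rule u_continuous) (use t0 in auto)
    from continuous_on_diff[OF cont this]
    show "continuous_on ({t0..T} \<times> {l..r}) (\<lambda>(t,x). w t x - u t x)"
      by (simp add: case_prod_unfold)
    fix s y assume s: "t0 < s" "s \<le> T" "l < y" "y < r" "0 < w s y - u s y"
    have w: "w s y \<le> 1" "wt s y \<le> wxx s y + f (w s y)" using sub[OF s(1-4)] s by auto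
    \<comment> \<open>Where \<open>w\<close> exceeds \<open>u\<close> it is automatically positive,
      so a comparison function may be negative elsewhere without any condition there.\<close>
    have "f (w s y) - f (u s y) \<le> fD 0 * (w s y - u s y)"
      by (rule f_one_sided_lipschitz) (use u_range[of s y] w s t0 in auto)
    with w show "heat_subsolution_at {l<..<r} (fD 0) (\<lambda>t x. w t x - u t x) s y"
      by (intro heat_subsolution_diff_below[OF _ D(1) D(2) D(3)]) (use s t0 in auto)
  qed (use init left right tx in auto)
  then show ?thesis by simp
qed

text \<open>The arch \<open>e * cos (om * (x - x0))\<close> is a stationary subsolution, because its
  second derivative is \<open>- om^2\<close> times itself; it vanishes at the ends of the window and
  equals \<open>e\<close> at the centre.\<close>

lemma bump_persists:
  assumes t0: "0 \<le> t0" "t0 \<le> t" and om: "0 < om" and e: "0 < e" "e \<le> 1"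
    and f: "\<And>s. 0 \<le> s \<Longrightarrow> s \<le> e \<Longrightarrow> om\<^sup>2 * s \<le> f s"
    and u: "\<And>x. \<bar>x - x0\<bar> \<le> pi / (2 * om) \<Longrightarrow> e \<le> u t0 x"
  shows "e \<le> u t x0"
proof -
  define l where "l = x0 - pi / (2 * om)"
  define r where "r = x0 + pi / (2 * om)"
  have "e * cos (om * (x0 - x0)) \<le> u t x0"
  proof (rule compare_rectangle[where w = "\<lambda>t x. e * cos (om * (x - x0))" and ?t0.0 = t0 and T = t and l = l and r = r
        and wt = "\<lambda>_ _. 0" and wx = "\<lambda>_ x. - e * om * sin (om * (x - x0))"
        and wxx = "\<lambda>_ x. - e * om\<^sup>2 * cos (om * (x - x0))"])
    show "continuous_on ({t0..t} \<times> {l..r}) (\<lambda>(t,x). e * cos (om * (x - x0)))"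
      unfolding case_prod_unfold by (intro continuous_intros)
    show "e * cos (om * (x - x0)) \<le> u t0 x" if "l \<le> x" "x \<le> r" for x
    proof -
      have "e * cos (om * (x - x0)) \<le> e * 1" using e by (intro mult_left_mono) auto
      also have "\<dots> \<le> u t0 x" using u[of x] that by (auto simp: l_def r_def)
      finally show ?thesis .
    qed
    have [simp]: "om * (l - x0) = - (pi / 2)" "om * (r - x0) = pi / 2"
      using om by (auto simp: l_def r_def)
    show "e * cos (om * (l - x0)) \<le> u s l" "e * cos (om * (r - x0)) \<le> u s r"
      if "t0 \<le> s" for s using u_range(1)[of s] that t0 by auto
    show "((\<lambda>y. e * cos (om * (y - x0))) has_real_derivative - e * om * sin (om * (x - x0))) (at x)" for x
      by (auto intro!: derivative_eq_intros)
    show "((\<lambda>y. - e * om * sin (om * (y - x0))) has_real_derivative - e * om\<^sup>2 * cos (om * (x - x0))) (at x)" for x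
      by (auto intro!: derivative_eq_intros simp: power2_eq_square)
    show "e * cos (om * (x - x0)) \<le> 1 \<and> 0 \<le> - e * om\<^sup>2 * cos (om * (x - x0)) + f (e * cos (om * (x - x0)))"
      if "t0 < s" "u s x < e * cos (om * (x - x0))" for s x
    proof -
      have "0 \<le> e * cos (om * (x - x0))" using u_range(1)[of s x] that t0 by auto
      moreover have "e * cos (om * (x - x0)) \<le> e * 1" using e by (intro mult_left_mono) auto
      ultimately have "om\<^sup>2 * (e * cos (om * (x - x0))) \<le> f (e * cos (om * (x - x0)))"
          "e * cos (om * (x - x0)) \<le> 1"
        using f[of "e * cos (om * (x - x0))"] e by linarith+
      then show ?thesis by (simp add: mult.assoc mult.left_commute)
    qed
    show "l \<le> x0" "x0 \<le> r" using om by (auto simp: l_def r_def)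
  qed (use t0 in auto)
  then show ?thesis by simp
qed

text \<open>\<open>w\<close> below is a parabola rising from 0 at \<open>b - 2 * L\<close> to
  \<open>e\<close> at \<open>b\<close>, minus a decaying constant that makes it nonpositive
  initially. With \<open>g = 2 * j^2\<close> its time derivative never exceeds its second space
  derivative, so \<open>f >= 0\<close> suffices.\<close>

lemma positivity_spreads_left:
  assumes t1: "0 \<le> t1" and L: "0 < L" and e: "0 < e" "e \<le> 1"
    and u: "\<And>t. t1 \<le> t \<Longrightarrow> e \<le> u t b"
  obtains t2 where "t1 \<le> t2" "\<And>t x. t2 \<le> t \<Longrightarrow> b - L \<le> x \<Longrightarrow> x \<le> b \<Longrightarrow> e / 8 \<le> u t x"
proof -
  define j where "j = 1 / (2 * L)"
  have j: "0 < j" "j * (2 * L) = 1" using L by (simp_all add: j_def)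
  define g where "g = 2 * j\<^sup>2"
  have g: "0 < g" using j by (simp add: g_def)
  define l where "l = b - 2 * L"
  define w where "w = (\<lambda>t x. e * ((j * (x - l))\<^sup>2 - exp (- g * (t - t1))))"
  have main: "w t x \<le> u t x" if tx: "t1 \<le> t" "l \<le> x" "x \<le> b" for t x
  proof (rule compare_rectangle[where w = w and ?t0.0 = t1 and T = t and l = l and r = b
        and wt = "\<lambda>t x. e * g * exp (- g * (t - t1))" and wx = "\<lambda>_ x. e * g * (x - l)"
        and wxx = "\<lambda>_ x. e * g"])
    have sq: "(j * (y - l))\<^sup>2 \<le> 1" if "l \<le> y" "y \<le> b" for y
    proof -
      have "j * (y - l) \<le> j * (2 * L)" using that j by (intro mult_left_mono) (auto simp: l_def)
      then have "(j * (y - l))\<^sup>2 \<le> 1\<^sup>2"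
        using that j by (intro power_mono) auto
      then show ?thesis by simp
    qed
    have nonneg: "0 \<le> u s y" if "t1 \<le> s" for s y using u_range(1)[of s y] that t1 by auto
    show "continuous_on ({t1..t} \<times> {l..b}) (\<lambda>(t,x). w t x)"
      unfolding case_prod_unfold w_def by (intro continuous_intros)
    show "w t1 y \<le> u t1 y" if "l \<le> y" "y \<le> b" for y
    proof -
      have "w t1 y \<le> 0" using sq[OF that] e by (simp add: w_def mult_le_0_iff)
      then show ?thesis using nonneg[of t1 y] by simp
    qed
    show "w s l \<le> u s l" if "t1 \<le> s" for s
    proof -
      have "w s l \<le> 0" using e by (simp add: w_def mult_le_0_iff)
      then show ?thesis using nonneg[OF that, of l] by simp
    qed
    have w_le: "w s y \<le> e" if "l \<le> y" "y \<le> b" for s y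
    proof -
      have "(j * (y - l))\<^sup>2 - exp (- g * (s - t1)) \<le> 1"
        using sq[OF that] exp_gt_zero[of "- g * (s - t1)"] by linarith
      then have "w s y \<le> e * 1" unfolding w_def using e by (intro mult_left_mono) auto
      then show ?thesis by simp
    qed
    show "w s b \<le> u s b" if "t1 \<le> s" for s
      using w_le[of b s] u[OF that] L by (simp add: l_def)
    show "((\<lambda>s. w s x) has_real_derivative e * g * exp (- g * (t - t1))) (at t)" for t x
      unfolding w_def by (auto intro!: derivative_eq_intros)
    show "((\<lambda>y. w t y) has_real_derivative e * g * (x - l)) (at x)" for t x
      unfolding w_def g_def by (auto intro!: derivative_eq_intros simp: power2_eq_square)
    show "((\<lambda>y. e * g * (y - l)) has_real_derivative e * g) (at x)" for x
      by (auto intro!: derivative_eq_intros)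
    show "w s y \<le> 1 \<and> e * g * exp (- g * (s - t1)) \<le> e * g + f (w s y)"
      if s: "t1 < s" "l < y" "y < b" "u s y < w s y" for s y
    proof -
      have "w s y \<le> 1" using w_le[of y s] s e by simp
      moreover from this have "0 \<le> f (w s y)" using nonneg[of s y] s by (intro f_nonneg) auto
      moreover have "e * g * exp (- g * (s - t1)) \<le> e * g * 1"
        using e g s by (intro mult_left_mono) auto
      ultimately show ?thesis by simp
    qed
  qed (use tx t1 in auto)
  \<comment> \<open>From this time on the subtracted exponential is at most 1/8, while the square is
    at least 1/4 on the right half of the interval.\<close>
  define t2 where "t2 = t1 + ln 8 / g"
  have "e / 8 \<le> u t x" if t: "t2 \<le> t" and x: "b - L \<le> x" "x \<le> b" for t x
  proof -
    have "ln 8 \<le> g * (t - t1)" using t g by (simp add: t2_def field_simps)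
    then have "exp (- g * (t - t1)) \<le> exp (- ln 8)" by simp
    also have "\<dots> = 1 / 8" by (simp add: exp_minus)
    finally have ex: "exp (- g * (t - t1)) \<le> 1 / 8" .
    have "j * L \<le> j * (x - l)" using x j by (intro mult_left_mono) (auto simp: l_def)
    moreover have "j * L = 1 / 2" using j(2) by simp
    ultimately have "1 / 2 \<le> j * (x - l)" by simp
    then have "(1 / 2)\<^sup>2 \<le> (j * (x - l))\<^sup>2" by (intro power_mono) auto
    then have "1 / 8 \<le> (j * (x - l))\<^sup>2 - exp (- g * (t - t1))"
      using ex by (simp add: power2_eq_square)
    then have "e * (1 / 8) \<le> w t x" unfolding w_def using e by (intro mult_left_mono) auto
    moreover have "t1 \<le> t2" using g by (simp add: t2_def)
    ultimately show ?thesis using main[of t x] x L t by (simp add: l_def)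
  qed
  moreover have "t1 \<le> t2" using g by (simp add: t2_def)
  ultimately show ?thesis using that by blast
qed

text \<open>A paraboloid rises at speed \<open>k\<close> from \<open>e\<close> to \<open>b\<close>.
  Its curvature costs \<open>m / 2\<close> and its speed at most \<open>m / 2\<close>, both paid for
  by the minimum \<open>m\<close> of \<open>f\<close> on \<open>[e, b]\<close>. The window and the
  waiting time do not depend on \<open>t0\<close> and \<open>x0\<close>.\<close>

lemma plateau_rises:
  assumes e: "0 < e" and b: "e \<le> b" "b < 1"
  obtains L T where "0 < L" "0 < T"
    "\<And>t0 x0. 0 \<le> t0 \<Longrightarrow> (\<And>t x. t0 \<le> t \<Longrightarrow> t \<le> t0 + T \<Longrightarrow> \<bar>x - x0\<bar> \<le> L \<Longrightarrow> e \<le> u t x) \<Longrightarrow>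
      b \<le> u (t0 + T) x0"
proof -
  have "continuous_on {e..b} f"
    using f_deriv by (intro continuous_at_imp_continuous_on) (auto intro: DERIV_isCont)
  then obtain z where z: "z \<in> {e..b}" "\<And>s. s \<in> {e..b} \<Longrightarrow> f z \<le> f s"
    using continuous_attains_inf[of "{e..b}" f] b by auto
  define m where "m = f z"
  have m: "0 < m" using f_pos[of z] z e b by (auto simp: m_def)
  \<comment> \<open>The added 1 keeps \<open>T\<close> positive when \<open>b = e\<close>.\<close>
  define T where "T = (b - e) * 2 / m + 1"
  define k where "k = (b - e) / T"
  have T: "0 < T" using m b by (auto simp: T_def intro: add_nonneg_pos)
  have k: "0 \<le> k" "k \<le> m / 2" "e + k * T = b"
  proof -
    show "0 \<le> k" using T b by (simp add: k_def)
    show "e + k * T = b" using T by (simp add: k_def)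
    have "b - e \<le> m / 2 * T" using m by (simp add: T_def field_simps)
    then show "k \<le> m / 2" using T by (simp add: k_def field_simps)
  qed
  \<comment> \<open>At this distance the paraboloid has dropped by 1, hence lies below zero.\<close>
  define L where "L = 2 / sqrt m"
  have L: "0 < L" "m / 4 * L\<^sup>2 = 1" using m by (auto simp: L_def power_divide)
  have "b \<le> u (t0 + T) x0"
    if t0: "0 \<le> t0" and u: "\<And>t x. t0 \<le> t \<Longrightarrow> t \<le> t0 + T \<Longrightarrow> \<bar>x - x0\<bar> \<le> L \<Longrightarrow> e \<le> u t x" for t0 x0
  proof -
    define w where "w = (\<lambda>t x. e + k * (t - t0) - m / 4 * (x - x0)\<^sup>2)"
    have "w (t0 + T) x0 \<le> u (t0 + T) x0"
    proof (rule compare_rectangle[where w = w and ?t0.0 = t0 and T = "t0 + T" and l = "x0 - L" and r = "x0 + L"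
          and wt = "\<lambda>_ _. k" and wx = "\<lambda>_ x. - (m / 2) * (x - x0)" and wxx = "\<lambda>_ _. - (m / 2)"])
      have w_le: "w t x \<le> b" if "t \<le> t0 + T" for t x
      proof -
        have "k * (t - t0) \<le> k * T" using that k by (intro mult_left_mono) auto
        moreover have "0 \<le> m / 4 * (x - x0)\<^sup>2" using m by (intro mult_nonneg_nonneg) auto
        ultimately show ?thesis using k(3) unfolding w_def by linarith
      qed
      show "continuous_on ({t0..t0 + T} \<times> {x0 - L..x0 + L}) (\<lambda>(t,x). w t x)"
        unfolding case_prod_unfold w_def by (intro continuous_intros)
      show "w t0 x \<le> u t0 x" if "x0 - L \<le> x" "x \<le> x0 + L" for x
      proof -
        have "w t0 x \<le> e" using m by (simp add: w_def mult_nonneg_nonneg)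
        also have "e \<le> u t0 x" using u[of t0 x] that T by auto
        finally show ?thesis .
      qed
      have edge: "w t x \<le> u t x" if "(x - x0)\<^sup>2 = L\<^sup>2" "t0 \<le> t" "t \<le> t0 + T" for t x
      proof -
        have "w t x = e + k * (t - t0) - 1" using that L(2) by (simp add: w_def)
        also have "\<dots> \<le> b - 1" using mult_left_mono[of "t - t0" T k] that k by simp
        finally show ?thesis using b u_range(1)[of t x] that t0 by simp
      qed
      show "w t (x0 - L) \<le> u t (x0 - L)" "w t (x0 + L) \<le> u t (x0 + L)"
        if "t0 \<le> t" "t \<le> t0 + T" for t using edge that by auto
      show "((\<lambda>s. w s x) has_real_derivative k) (at t)" for t x
        unfolding w_def by (auto intro!: derivative_eq_intros)
      show "((\<lambda>y. w t y) has_real_derivative - (m / 2) * (x - x0)) (at x)" for t x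
        unfolding w_def by (auto intro!: derivative_eq_intros)
      show "((\<lambda>y. - (m / 2) * (y - x0)) has_real_derivative - (m / 2)) (at x)" for x
        by (auto intro!: derivative_eq_intros)
      show "w t x \<le> 1 \<and> k \<le> - (m / 2) + f (w t x)"
        if t: "t0 < t" "t \<le> t0 + T" "x0 - L < x" "x < x0 + L" "u t x < w t x" for t x
      proof -
        have "e \<le> u t x" using u[of t x] t by auto
        then have "m \<le> f (w t x)" using w_le[OF t(2), of x] t unfolding m_def by (intro z(2)) auto
        then show ?thesis using k(2) w_le[OF t(2), of x] b by linarith
      qed
    qed (use t0 T L in auto)
    then show ?thesis using k(3) by (simp add: w_def)
  qed
  with L(1) T show ?thesis using that by blast
qed

end

section \<open>Comparison with the front\<close>

locale kpp_cauchy = kpp_front + kpp_solution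
begin

text \<open>Since \<open>f s / s\<close> is nonincreasing, \<open>(1 \<plusminus> Psi)\<close> times the front is a super- and a subsolution as
  soon as \<open>Psi\<close> is a supersolution of \<open>Psi_t = Psi_xx + 2 (U' / U) Psi_x\<close>. Ahead of the front this is
  transport with speed \<open>2 * lam < c\<close>, so an exponential qualifies if it decreases in \<open>x\<close> and moves
  slightly faster or increases and moves slightly slower; \<open>E3\<close> pays for the region behind \<open>Z\<close>,
  where the drift has not yet reached \<open>2 * lam\<close>.\<close>

lemma front_barrier:
  fixes \<alpha> S Z T e E1 E2 E3 :: real
  defines "Psi \<equiv> \<lambda>s x. e + E1 * exp (- \<alpha> * (x - (2 * lam + \<alpha>) * s))
      + E2 * exp (\<alpha> * (x - (2 * lam - 2 * \<alpha>) * s)) + E3 * s"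
  assumes al: "0 < \<alpha>" and T: "0 \<le> T" and e: "0 \<le> e" "0 \<le> E1" "0 \<le> E2"
    and Z: "\<And>z. Z \<le> z \<Longrightarrow> tail_slope z \<le> \<alpha> / 2 * U z"
    and E3: "E3 = 2 * lam * \<alpha> * E2 * exp (\<alpha> * (Z + S) + \<alpha> * (del + 2 * \<alpha>) * T)"
    and init: "\<And>x. \<bar>u0 x - U (x - S)\<bar> \<le> Psi 0 x * U (x - S)"
  shows "\<bar>u T x - U (x - c * T - S)\<bar> \<le> Psi T x * U (x - c * T - S)"
proof -
  define T1 where "T1 = (\<lambda>s x. E1 * exp (- \<alpha> * (x - (2 * lam + \<alpha>) * s)))"
  define T2 where "T2 = (\<lambda>s x. E2 * exp (\<alpha> * (x - (2 * lam - 2 * \<alpha>) * s)))"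
  have Psi: "Psi s x = e + T1 s x + T2 s x + E3 * s" for s x
    by (simp add: Psi_def T1_def T2_def)
  have E3_nonneg: "0 \<le> E3" using E3 al lam_pos e by simp
  have T1_nonneg: "0 \<le> T1 s x" and T2_nonneg: "0 \<le> T2 s x" for s x
    using e by (auto simp: T1_def T2_def)
  have Psi_nonneg: "0 \<le> Psi s x" if "0 \<le> s" for s x
    using T1_nonneg[of s x] T2_nonneg[of s x] E3_nonneg e that by (simp add: Psi)
  define Pt where "Pt = (\<lambda>s x. \<alpha> * (2 * lam + \<alpha>) * T1 s x - \<alpha> * (2 * lam - 2 * \<alpha>) * T2 s x + E3)"
  define Px where "Px = (\<lambda>s x. - \<alpha> * T1 s x + \<alpha> * T2 s x)"
  define Pxx where "Pxx = (\<lambda>s x. \<alpha>\<^sup>2 * T1 s x + \<alpha>\<^sup>2 * T2 s x)"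
  have dT1t: "((\<lambda>s. T1 s x) has_real_derivative \<alpha> * (2 * lam + \<alpha>) * T1 s x) (at s)"
    and dT2t: "((\<lambda>s. T2 s x) has_real_derivative - \<alpha> * (2 * lam - 2 * \<alpha>) * T2 s x) (at s)"
    and dT1: "((\<lambda>x. T1 s x) has_real_derivative - \<alpha> * T1 s x) (at x)"
    and dT2: "((\<lambda>x. T2 s x) has_real_derivative \<alpha> * T2 s x) (at x)" for s x
    unfolding T1_def T2_def by (auto intro!: derivative_eq_intros simp: algebra_simps)
  have dPt: "((\<lambda>s. Psi s x) has_real_derivative Pt s x) (at s)" for s x
    unfolding Psi Pt_def by (auto intro!: derivative_eq_intros dT1t dT2t)
  have dPx: "((\<lambda>x. Psi s x) has_real_derivative Px s x) (at x)" for s x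
    unfolding Psi Px_def by (auto intro!: derivative_eq_intros dT1 dT2)
  have dPxx: "((\<lambda>x. Px s x) has_real_derivative Pxx s x) (at x)" for s x
    unfolding Px_def Pxx_def by (auto intro!: derivative_eq_intros dT1 dT2 simp: power2_eq_square)
  define \<xi> where "\<xi> = (\<lambda>s x. x - c * s - S)"
  \<comment> \<open>\<open>N\<close> is what the perturbation \<open>Psi * U\<close> of the front
    adds to the equation; its nonnegativity is the supersolution property of
    \<open>Psi\<close>.\<close>
  define N where "N = (\<lambda>s x. (Pt s x - Pxx s x) * U (\<xi> s x) - 2 * Px s x * deriv U (\<xi> s x))"
  have N_nonneg: "0 \<le> N s x" if s: "0 \<le> s" "s \<le> T" for s x
  proof -
    define z where "z = \<xi> s x"
    have "N s x = (Pt s x - Pxx s x) * U z - 2 * Px s x * (tail_slope z - lam * U z)"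
      by (simp add: N_def z_def tail_slope_def)
    then have N: "N s x = 2 * \<alpha> * T1 s x * tail_slope z + \<alpha> * T2 s x * (\<alpha> * U z - 2 * tail_slope z) + E3 * U z"
      by (simp add: Pt_def Px_def Pxx_def algebra_simps power2_eq_square)
    have 1: "0 \<le> 2 * \<alpha> * T1 s x * tail_slope z" using al T1_nonneg[of s x] tail_slope_nonneg[of z] by simp
    have 2: "0 \<le> \<alpha> * T2 s x" using al T2_nonneg[of s x] by simp
    show ?thesis
    proof (cases "Z \<le> z")
      case True
      have "0 \<le> \<alpha> * T2 s x * (\<alpha> * U z - 2 * tail_slope z)"
        using Z[OF True] by (intro mult_nonneg_nonneg[OF 2]) simp
      then show ?thesis using 1 E3_nonneg U_pos[of z] unfolding N by simp
    next
      case False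
      \<comment> \<open>Behind \<open>Z\<close> the growing exponential is largest at
        \<open>z = Z\<close> and at the final time; \<open>E3\<close> is
        \<open>2 * lam * \<alpha>\<close> times that value.\<close>
      have "\<alpha> * (x - (2 * lam - 2 * \<alpha>) * s) = \<alpha> * (z + S) + \<alpha> * (del + 2 * \<alpha>) * s"
        by (simp add: z_def \<xi>_def c_del algebra_simps)
      also have "\<dots> \<le> \<alpha> * (Z + S) + \<alpha> * (del + 2 * \<alpha>) * T"
        using False al s del_pos by (intro add_mono mult_left_mono) auto
      finally have "T2 s x \<le> E2 * exp (\<alpha> * (Z + S) + \<alpha> * (del + 2 * \<alpha>) * T)"
        unfolding T2_def using e by (intro mult_left_mono) auto
      then have "2 * lam * \<alpha> * T2 s x \<le> 2 * lam * \<alpha> * (E2 * exp (\<alpha> * (Z + S) + \<alpha> * (del + 2 * \<alpha>) * T))"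
        using lam_pos al by (intro mult_left_mono) auto
      then have "2 * lam * \<alpha> * T2 s x \<le> E3" by (simp add: E3 mult.assoc)
      then have "2 * lam * \<alpha> * T2 s x * U z \<le> E3 * U z"
        using U_pos[of z] by (intro mult_right_mono) auto
      moreover have "\<alpha> * T2 s x * (- 2 * lam * U z) \<le> \<alpha> * T2 s x * (\<alpha> * U z - 2 * tail_slope z)"
      proof (intro mult_left_mono 2)
        have "0 \<le> \<alpha> * U z" using al U_pos[of z] by simp
        then show "- 2 * lam * U z \<le> \<alpha> * U z - 2 * tail_slope z" using tail_slope_le[of z] by simp
      qed
      ultimately show ?thesis using 1 unfolding N by (simp add: algebra_simps)
    qed
  qed
  \<comment> \<open>The sign \<open>\<sigma> = 1\<close> gives the supersolution and
    \<open>\<sigma> = - 1\<close> the subsolution.\<close>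
  define W where "W = (\<lambda>\<sigma> s x. (1 + \<sigma> * Psi s x) * U (\<xi> s x))"
  define Wt where "Wt = (\<lambda>\<sigma> s x. \<sigma> * Pt s x * U (\<xi> s x) - (1 + \<sigma> * Psi s x) * (c * deriv U (\<xi> s x)))"
  define Wx where "Wx = (\<lambda>\<sigma> s x. \<sigma> * Px s x * U (\<xi> s x) + (1 + \<sigma> * Psi s x) * deriv U (\<xi> s x))"
  define Wxx where "Wxx = (\<lambda>\<sigma> s x. \<sigma> * Pxx s x * U (\<xi> s x) + 2 * (\<sigma> * Px s x * deriv U (\<xi> s x))
      - (1 + \<sigma> * Psi s x) * (c * deriv U (\<xi> s x) + f (U (\<xi> s x))))"
  have dU: "((\<lambda>x. U (\<xi> s x)) has_real_derivative deriv U (\<xi> s x)) (at x)"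
    "((\<lambda>x. deriv U (\<xi> s x)) has_real_derivative - (c * deriv U (\<xi> s x) + f (U (\<xi> s x)))) (at x)"
    "((\<lambda>s. U (\<xi> s x)) has_real_derivative - (c * deriv U (\<xi> s x))) (at s)" for s x
  proof -
    have x: "((\<lambda>x. \<xi> s x) has_real_derivative 1) (at x)" and s: "((\<lambda>s. \<xi> s x) has_real_derivative - c) (at s)"
      unfolding \<xi>_def by (rule derivative_eq_intros refl | simp)+
    show "((\<lambda>x. U (\<xi> s x)) has_real_derivative deriv U (\<xi> s x)) (at x)"
      using DERIV_chain2[OF U_deriv x] by simp
    show "((\<lambda>x. deriv U (\<xi> s x)) has_real_derivative - (c * deriv U (\<xi> s x) + f (U (\<xi> s x)))) (at x)"
      using DERIV_chain2[OF U_deriv2 x] by simp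
    show "((\<lambda>s. U (\<xi> s x)) has_real_derivative - (c * deriv U (\<xi> s x))) (at s)"
      using DERIV_chain2[OF U_deriv s] by (simp add: mult.commute)
  qed
  have dWt: "((\<lambda>s. W \<sigma> s x) has_real_derivative Wt \<sigma> s x) (at s)" for \<sigma> s x
    unfolding W_def Wt_def
    by (rule derivative_eq_intros refl dU dPt)+ (simp add: algebra_simps)
  have dWx: "((\<lambda>x. W \<sigma> s x) has_real_derivative Wx \<sigma> s x) (at x)" for \<sigma> s x
    unfolding W_def Wx_def
    by (rule derivative_eq_intros refl dU dPx)+ (simp add: algebra_simps)
  have dWxx: "((\<lambda>x. Wx \<sigma> s x) has_real_derivative Wxx \<sigma> s x) (at x)" for \<sigma> s x
    unfolding Wx_def Wxx_def
    by (rule derivative_eq_intros refl dU dPx dPxx)+ (simp add: algebra_simps)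
  have eq: "Wt \<sigma> s x - Wxx \<sigma> s x = \<sigma> * N s x + (1 + \<sigma> * Psi s x) * f (U (\<xi> s x))" for \<sigma> s x
    by (simp add: Wt_def Wxx_def N_def algebra_simps)
  have W0: "W \<sigma> 0 x = U (x - S) + \<sigma> * (Psi 0 x * U (x - S))" for \<sigma> x
    by (simp add: W_def \<xi>_def algebra_simps)
  have U_cont: "continuous_on X U" for X
    by (rule DERIV_continuous_on) (rule has_field_derivative_at_within[OF U_deriv])
  have W_cont: "continuous_on ({0..T} \<times> UNIV) (\<lambda>(s,x). W \<sigma> s x)" for \<sigma>
    unfolding W_def Psi_def \<xi>_def case_prod_unfold
    by (intro continuous_intros continuous_on_compose2[OF U_cont[of UNIV]] subset_UNIV)
  have u_cont: "continuous_on ({0..T} \<times> UNIV) (\<lambda>(s,x). u s x)"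
    by (rule u_continuous) auto
  have "(\<lambda>s x. u s x - W 1 s x) T x \<le> 0"
  proof (rule max_principle_strip[where d = "\<lambda>s x. u s x - W 1 s x" and T = T and B = 1 and K = "fD 0"])
    show "continuous_on ({0..T} \<times> UNIV) (\<lambda>(s,x). u s x - W 1 s x)"
      using continuous_on_diff[OF u_cont W_cont] by (simp add: case_prod_unfold)
    show "u s y - W 1 s y \<le> 1" if "0 \<le> s" for s y
    proof -
      have "0 \<le> W 1 s y" unfolding W_def
        using Psi_nonneg[OF that, of y] U_pos[of "\<xi> s y"] by (intro mult_nonneg_nonneg) auto
      then show ?thesis using u_range[OF that, of y] by simp
    qed
    show "u 0 y - W 1 0 y \<le> 0" for y
      using init[of y] unfolding W0 u_initial by simp
    fix s y assume s: "0 < s" "s \<le> T" and pos: "0 < u s y - W 1 s y"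
    define V where "V = U (\<xi> s y)"
    have V: "0 < V" using U_pos by (simp add: V_def)
    have P: "0 \<le> Psi s y" using s by (intro Psi_nonneg) simp
    have W: "W 1 s y = (1 + Psi s y) * V" by (simp add: W_def V_def)
    have "1 * V \<le> (1 + Psi s y) * V" using V P by (intro mult_right_mono) auto
    then have VW: "V \<le> W 1 s y" by (simp add: W)
    have u1: "u s y \<le> 1" using u_range[of s y] s by simp
    \<comment> \<open>\<open>W\<close> may exceed 1 in general, but here it lies below
      \<open>u <= 1\<close>, where monotonicity of \<open>f s / s\<close> is available.\<close>
    have "f (W 1 s y) * V \<le> f V * W 1 s y" using V VW pos u1 by (intro f_cross_le) auto
    then have "f (W 1 s y) * V \<le> (1 + Psi s y) * f V * V" by (simp add: W algebra_simps)
    then have "f (W 1 s y) \<le> (1 + Psi s y) * f V" using V by simp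
    moreover have "f (u s y) - f (W 1 s y) \<le> fD 0 * (u s y - W 1 s y)"
      using V VW pos u1 by (intro f_one_sided_lipschitz) auto
    moreover have "(1 + Psi s y) * f V \<le> Wt 1 s y - Wxx 1 s y"
      using N_nonneg[of s y] s unfolding eq V_def by simp
    ultimately show "heat_subsolution_at UNIV (fD 0) (\<lambda>s x. u s x - W 1 s x) s y"
      by (intro heat_subsolution_diff_above[OF s(1) dWt dWx dWxx]) simp
  qed (use T in auto)
  then have upper: "u T x \<le> W 1 T x" by simp
  have "(\<lambda>s x. W (- 1) s x - u s x) T x \<le> 0"
  proof (rule max_principle_strip[where d = "\<lambda>s x. W (- 1) s x - u s x" and T = T and B = 1 and K = "fD 0"])
    show "continuous_on ({0..T} \<times> UNIV) (\<lambda>(s,x). W (- 1) s x - u s x)"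
      using continuous_on_diff[OF W_cont u_cont] by (simp add: case_prod_unfold)
    have W_le: "W (- 1) s y \<le> U (\<xi> s y)" if "0 \<le> s" for s y
      using mult_nonneg_nonneg[OF Psi_nonneg[OF that, of y], of "U (\<xi> s y)"] U_pos[of "\<xi> s y"]
      by (simp add: W_def algebra_simps)
    show "W (- 1) s y - u s y \<le> 1" if "0 \<le> s" for s y
      using W_le[OF that, of y] u_range[OF that, of y] U_less_1[of "\<xi> s y"] by simp
    show "W (- 1) 0 y - u 0 y \<le> 0" for y
      using init[of y] unfolding W0 u_initial by simp
    fix s y assume s: "0 < s" "s \<le> T" and pos: "0 < W (- 1) s y - u s y"
    define V where "V = U (\<xi> s y)"
    have V: "0 < V" "V < 1" using U_pos U_less_1 by (simp_all add: V_def)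
    have W: "W (- 1) s y = (1 - Psi s y) * V" by (simp add: W_def V_def)
    have WV: "W (- 1) s y \<le> V" using W_le[of s y] s by (simp add: V_def)
    have u0: "0 \<le> u s y" using u_range[of s y] s by simp
    \<comment> \<open>\<open>W\<close> may be negative in general, but here it lies above
      \<open>u >= 0\<close>.\<close>
    have "f V * W (- 1) s y \<le> f (W (- 1) s y) * V" using V WV pos u0 by (intro f_cross_le) auto
    then have "(1 - Psi s y) * f V * V \<le> f (W (- 1) s y) * V" by (simp add: W algebra_simps)
    then have "(1 - Psi s y) * f V \<le> f (W (- 1) s y)" using V by simp
    moreover have "f (W (- 1) s y) - f (u s y) \<le> fD 0 * (W (- 1) s y - u s y)"
      using V WV pos u0 by (intro f_one_sided_lipschitz) auto
    moreover have "Wt (- 1) s y - Wxx (- 1) s y \<le> (1 - Psi s y) * f V"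
      using N_nonneg[of s y] s unfolding eq V_def by simp
    ultimately show "heat_subsolution_at UNIV (fD 0) (\<lambda>s x. W (- 1) s x - u s x) s y"
      by (intro heat_subsolution_diff_below[OF s(1) dWt dWx dWxx]) simp
  qed (use T in auto)
  then have lower: "W (- 1) T x \<le> u T x" by simp
  show ?thesis using upper lower by (simp add: W_def \<xi>_def algebra_simps abs_le_iff)
qed

end

section \<open>Initial data with a prescribed tail and the resulting convergence\<close>

lemma exp_log_minus_linear_tendsto_0:
  fixes k b b0 :: real
  assumes "0 < k"
  shows "((\<lambda>t. exp (b * ln t + b0 - k * t)) \<longlongrightarrow> 0) at_top"
    and "((\<lambda>t. t * exp (b * ln t + b0 - k * t)) \<longlongrightarrow> 0) at_top"
  using assms by real_asymp+

lemma linear_minus_log_at_top: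
  fixes k b b0 :: real
  assumes "0 < k"
  shows "filterlim (\<lambda>t. k * t - (b * ln t + b0)) at_top at_top"
  using assms by real_asymp

lemma eventually_powr_le_exp:
  fixes k b :: real
  assumes "0 < k"
  shows "\<forall>\<^sub>F x in at_top. x powr b \<le> exp (k * x)"
  using assms by real_asymp

lemma exp_powr_at_top:
  fixes k b K :: real
  assumes "0 < k" "0 < K"
  shows "filterlim (\<lambda>t. exp (k * t) * (K * t powr b)) at_top at_top"
  using assms by real_asymp

locale kpp_cauchy_tail = kpp_cauchy +
  fixes nu a :: real
  assumes a_pos: "0 < a"
    and u0_tail: "\<forall>\<^sub>F x in at_top. u0 x = a * x powr nu * exp (- lam * x)"
begin

text \<open>Any small exponential absorbs the power of \<open>x\<close> far out; to the left of
  \<open>X\<close> the bound \<open>u0 <= 1\<close> suffices, as \<open>exp (- lam * x)\<close> is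
  bounded below there.\<close>

lemma u0_envelope:
  assumes k: "0 < k"
  obtains D where "0 < D" "\<And>x. u0 x \<le> D * exp (- lam * x) * exp (k * max x 0)"
proof -
  from eventually_conj[OF u0_tail eventually_powr_le_exp[OF k, of nu]]
  obtain X where X: "\<And>x. X \<le> x \<Longrightarrow> u0 x = a * x powr nu * exp (- lam * x)"
    "\<And>x. X \<le> x \<Longrightarrow> x powr nu \<le> exp (k * x)"
    by (auto simp: eventually_at_top_linorder)
  define D where "D = max a (exp (lam * \<bar>X\<bar>))"
  have D: "0 < D" "a \<le> D" "exp (lam * \<bar>X\<bar>) \<le> D" using a_pos by (auto simp: D_def)
  have "u0 x \<le> D * exp (- lam * x) * exp (k * max x 0)" for x
  proof (cases "X \<le> x")
    case True
    have "k * x \<le> k * max x 0" using k by (intro mult_left_mono) auto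
    then have "x powr nu \<le> exp (k * max x 0)" using X(2)[OF True] by (meson exp_le_cancel_iff order_trans)
    then have "a * x powr nu \<le> D * exp (k * max x 0)" using D a_pos by (intro mult_mono) auto
    then have "a * x powr nu * exp (- lam * x) \<le> D * exp (k * max x 0) * exp (- lam * x)"
      by (intro mult_right_mono) auto
    then show ?thesis using X(1)[OF True] by (simp add: mult_ac)
  next
    case False
    then have "lam * x \<le> lam * \<bar>X\<bar>" using lam_pos by (intro mult_left_mono) auto
    then have "1 \<le> exp (lam * \<bar>X\<bar>) * exp (- lam * x)" by (simp flip: exp_add)
    also have "\<dots> \<le> D * exp (- lam * x)" using D by (intro mult_right_mono) auto
    also have "\<dots> * 1 \<le> D * exp (- lam * x) * exp (k * max x 0)"
      using D k by (intro mult_left_mono) auto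
    finally show ?thesis using u0_range(2)[of x] by simp
  qed
  with D(1) show ?thesis by (rule that)
qed

text \<open>The shift is chosen for the final time \<open>t\<close>: the value at the front position at time \<open>t\<close> is
  transported from \<open>x = del * t\<close> at time \<open>0\<close>, which is where the ratio of \<open>u0\<close> to the shifted front
  has to be \<open>1\<close>. Elsewhere the ratio is at most \<open>exp (\<omega> * t)\<close> times an exponential.\<close>

lemma initial_ratio:
  fixes A sig e e1 \<alpha> \<omega> :: real
  defines "S \<equiv> \<lambda>t. nu / lam * ln t + sig"
  assumes A: "0 < A" "\<And>x. U x * exp (lam * x) \<le> A" "((\<lambda>x. U x * exp (lam * x)) \<longlongrightarrow> A) at_top"
    and sig: "A * exp (lam * sig) = a * del powr nu"
    and e: "0 < e" "e \<le> 1"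
    and e1: "0 < e1" "e1 < 1" "\<And>y. \<bar>y - 1\<bar> \<le> e1 \<Longrightarrow> \<bar>y powr nu - 1\<bar> \<le> e / 4"
    and al: "0 < \<alpha>" and om: "0 < \<omega>"
  shows "\<forall>\<^sub>F t in at_top. \<forall>x. \<bar>u0 x - U (x - S t)\<bar> \<le>
      (e + exp (\<omega> * t) * exp (- \<alpha> * (x - del * (1 - e1) * t))
         + exp (\<omega> * t) * exp (\<alpha> * (x - del * (1 + e1) * t))) * U (x - S t)"
proof -
  \<comment> \<open>\<open>k \<le> \<alpha>\<close> lets the envelope grow no faster than
    \<open>g2\<close>, and \<open>k * del \<le> \<omega> / 4\<close> keeps its cost at distance up
    to \<open>2 * del * t\<close> below \<open>exp (\<omega> / 2 * t)\<close>.\<close>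
  define k where "k = min \<alpha> (\<omega> / (4 * del))"
  have k: "0 < k" "k \<le> \<alpha>" "k * del \<le> \<omega> / 4"
    using al om del_pos by (auto simp: k_def min_def field_simps)
  obtain D where D: "0 < D" "\<And>x. u0 x \<le> D * exp (- lam * x) * exp (k * max x 0)"
    using u0_envelope[OF k(1)] by blast
  obtain X where X: "\<And>x. X \<le> x \<Longrightarrow> u0 x = a * x powr nu * exp (- lam * x)"
    using u0_tail by (auto simp: eventually_at_top_linorder)
  have "A / (1 + e / 4) < A" using A(1) e by (simp add: field_simps)
  from order_tendstoD(1)[OF A(3) this] obtain Z where
    Z: "\<And>z. Z \<le> z \<Longrightarrow> A / (1 + e / 4) < U z * exp (lam * z)"
    by (auto simp: eventually_at_top_linorder)
  have ev1: "\<forall>\<^sub>F t in at_top. Z \<le> del * (1 - e1) * t - S t"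
    unfolding S_def using linear_minus_log_at_top[of "del * (1 - e1)" "nu / lam" sig] del_pos e1
    by (simp add: filterlim_at_top)
  have ev2: "\<forall>\<^sub>F t in at_top. X \<le> del * (1 - e1) * t"
  proof -
    have "filterlim (\<lambda>t. del * (1 - e1) * t) at_top at_top"
      using linear_minus_log_at_top[of "del * (1 - e1)" 0 0] del_pos e1 by simp
    then show ?thesis by (simp add: filterlim_at_top)
  qed
  have ev3: "\<forall>\<^sub>F t in at_top. 1 \<le> exp (\<omega> * t) * (U 0 * t powr 0)"
    using exp_powr_at_top[OF om U_pos, of 0 0] by (simp add: filterlim_at_top)
  have ev4: "\<forall>\<^sub>F t in at_top. D \<le> exp (\<omega> / 2 * t) * (U 0 * exp (lam * sig) * t powr nu)"
    using exp_powr_at_top[of "\<omega> / 2" "U 0 * exp (lam * sig)" nu] om U_pos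
    by (simp add: filterlim_at_top)
  show ?thesis
    using ev1 ev2 ev3 ev4 eventually_gt_at_top[of 0]
  proof eventually_elim
    case (elim t)
    \<comment> \<open>The logarithmic shift amounts to the factor \<open>t powr nu\<close> in the
      exponential tail.\<close>
    have expS: "exp (lam * S t) = t powr nu * exp (lam * sig)"
      using elim lam_pos by (simp add: S_def powr_def distrib_left exp_add)
    show ?case
    proof
      fix x
      define g1 where "g1 = exp (- \<alpha> * (x - del * (1 - e1) * t))"
      define g2 where "g2 = exp (\<alpha> * (x - del * (1 + e1) * t))"
      define W where "W = U (x - S t)"
      have W: "0 < W" using U_pos by (simp add: W_def)
      have g: "0 \<le> exp (\<omega> * t) * g1" "0 \<le> exp (\<omega> * t) * g2" by (auto simp: g1_def g2_def)
      \<comment> \<open>Away from \<open>x = del * t\<close> a crude bound is enough: in the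
        exponential tail, half of \<open>exp (\<omega> * t)\<close> pays for constants and powers of
        \<open>t\<close>, the other half for the envelope.\<close>
      have outer: "\<bar>u0 x - W\<bar> \<le> exp (\<omega> * t) * h * W"
        if h: "1 \<le> h" "exp (k * max x 0) \<le> exp (\<omega> / 2 * t) * h" for h
      proof -
        have "1 * 1 \<le> exp (\<omega> * t) * h" using h om elim by (intro mult_mono) auto
        then have "1 * W \<le> exp (\<omega> * t) * h * W" using W by (intro mult_right_mono) auto
        moreover have "u0 x \<le> exp (\<omega> * t) * h * W"
          using U_lower[of "x - S t"]
        proof
          assume U0: "U 0 \<le> U (x - S t)"
          have "u0 x \<le> 1" by (rule u0_range)
          also have "\<dots> \<le> exp (\<omega> * t) * U 0" using elim by simp
          also have "\<dots> \<le> exp (\<omega> * t) * W" using U0 by (simp add: W_def)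
          also have "\<dots> = exp (\<omega> * t) * 1 * W" by simp
          also have "\<dots> \<le> exp (\<omega> * t) * h * W"
            using h W by (intro mult_right_mono mult_left_mono) auto
          finally show ?thesis .
        next
          assume U0: "U 0 * exp (- lam * (x - S t)) \<le> U (x - S t)"
          have "u0 x \<le> D * exp (- lam * x) * (exp (\<omega> / 2 * t) * h)"
            using D h by (intro order_trans[OF D(2)] mult_left_mono) auto
          also have "\<dots> \<le> (exp (\<omega> / 2 * t) * (U 0 * exp (lam * sig) * t powr nu)) * exp (- lam * x) * (exp (\<omega> / 2 * t) * h)"
            using elim h by (intro mult_right_mono) auto
          also have "\<dots> = (exp (\<omega> / 2 * t) * exp (\<omega> / 2 * t)) * h * (U 0 * (exp (lam * S t) * exp (- lam * x)))"
            by (simp add: expS mult_ac)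
          also have "\<dots> = exp (\<omega> * t) * h * (U 0 * exp (- lam * (x - S t)))"
            by (simp add: algebra_simps flip: exp_add)
          also have "\<dots> \<le> exp (\<omega> * t) * h * W"
            using U0 h by (intro mult_left_mono) (auto simp: W_def)
          finally show ?thesis .
        qed
        ultimately show ?thesis using u0_range(1)[of x] W by (intro abs_leI) linarith+
      qed
      consider "x \<le> del * (1 - e1) * t" | "del * (1 + e1) * t \<le> x"
        | "del * (1 - e1) * t \<le> x" "x \<le> del * (1 + e1) * t" by linarith
      then have "\<bar>u0 x - W\<bar> \<le> (e + exp (\<omega> * t) * g1 + exp (\<omega> * t) * g2) * W"
      proof cases
        case 1
        have "1 \<le> g1" using 1 al by (simp add: g1_def mult_nonneg_nonpos)
        have "max x 0 \<le> del * t"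
        proof -
          have "del * (1 - e1) * t \<le> del * t" "0 \<le> del * t" using del_pos e1 elim by auto
          then show ?thesis using 1 by linarith
        qed
        then have "k * max x 0 \<le> k * (del * t)" using k by (intro mult_left_mono) auto
        also have "\<dots> = (k * del) * t" by simp
        also have "\<dots> \<le> \<omega> / 4 * t" using k elim by (intro mult_right_mono) auto
        also have "\<dots> \<le> \<omega> / 2 * t" using om elim by simp
        finally have "exp (k * max x 0) \<le> exp (\<omega> / 2 * t) * 1" by simp
        also have "\<dots> \<le> exp (\<omega> / 2 * t) * g1" using \<open>1 \<le> g1\<close> by (intro mult_left_mono) auto
        finally have "\<bar>u0 x - W\<bar> \<le> exp (\<omega> * t) * g1 * W" by (rule outer[OF \<open>1 \<le> g1\<close>])
        also have "\<dots> \<le> (e + exp (\<omega> * t) * g1 + exp (\<omega> * t) * g2) * W"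
          using W g e by (intro mult_right_mono) auto
        finally show ?thesis .
      next
        case 2
        have "1 \<le> g2" using 2 al by (simp add: g2_def)
        have d: "0 \<le> del * (1 + e1) * t" "del * (1 + e1) * t \<le> 2 * (del * t)"
          using del_pos e1 elim by auto
        then have "k * max x 0 = k * (del * (1 + e1) * t) + k * (x - del * (1 + e1) * t)"
          using 2 by (simp add: algebra_simps max_def)
        also have "\<dots> \<le> k * (2 * (del * t)) + \<alpha> * (x - del * (1 + e1) * t)"
          using d k 2 by (intro add_mono mult_left_mono mult_right_mono) auto
        also have "k * (2 * (del * t)) = 2 * ((k * del) * t)" by simp
        also have "\<dots> \<le> 2 * (\<omega> / 4 * t)" using k elim by (intro mult_left_mono mult_right_mono) auto
        finally have "k * max x 0 \<le> \<omega> / 2 * t + \<alpha> * (x - del * (1 + e1) * t)" by simp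
        then have "exp (k * max x 0) \<le> exp (\<omega> / 2 * t) * g2" by (simp add: g2_def flip: exp_add)
        then have "\<bar>u0 x - W\<bar> \<le> exp (\<omega> * t) * g2 * W" by (rule outer[OF \<open>1 \<le> g2\<close>])
        also have "\<dots> \<le> (e + exp (\<omega> * t) * g1 + exp (\<omega> * t) * g2) * W"
          using W g e by (intro mult_right_mono) auto
        finally show ?thesis .
      next
        case 3
        have dt: "0 < del * t" using del_pos elim by simp
        define y where "y = x / (del * t)"
        have xy: "x = y * (del * t)" using del_pos elim by (simp add: y_def)
        have "\<bar>y - 1\<bar> \<le> e1"
        proof -
          have "(1 - e1) * (del * t) \<le> y * (del * t)" "y * (del * t) \<le> (1 + e1) * (del * t)"
            using 3 unfolding xy[symmetric] by (simp_all add: mult_ac)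
          then have "1 - e1 \<le> y" "y \<le> 1 + e1"
            using dt by (simp_all only: mult_le_cancel_right_pos)
          then show ?thesis by (simp add: abs_le_iff)
        qed
        from e1(3)[OF this] have y: "y powr nu \<le> 1 + e / 4" "1 - e / 4 \<le> y powr nu"
          by linarith+
        have "0 < y" using \<open>\<bar>y - 1\<bar> \<le> e1\<close> e1 by auto
        \<comment> \<open>\<open>Q\<close> is the tail of \<open>u0\<close> with
          \<open>x powr nu\<close> frozen at \<open>x = del * t\<close>. By the choice of
          \<open>sig\<close>, \<open>W / Q\<close> equals \<open>Y / A\<close>, which is close to
          1.\<close>
        define Q where "Q = a * (del * t) powr nu * exp (- lam * x)"
        have Q: "0 < Q" using a_pos del_pos elim by (simp add: Q_def)
        have "x powr nu = y powr nu * (del * t) powr nu"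
          unfolding xy by (rule powr_mult)
        moreover have "X \<le> x" using elim 3 by linarith
        ultimately have u0: "u0 x = y powr nu * Q" using X[of x] by (simp add: Q_def)
        define Y where "Y = W * exp (lam * (x - S t))"
        have "Z \<le> x - S t" using elim 3 by simp
        from Z[OF this] have Y: "A / (1 + e / 4) < Y" "Y \<le> A" using A(2) by (auto simp: Y_def W_def)
        have "A * W = Y * Q"
        proof -
          have "Q = A * (exp (lam * S t) * exp (- lam * x))"
            using del_pos elim sig by (simp add: Q_def expS powr_mult mult_ac)
          then have "Y * Q = A * (W * (exp (lam * (x - S t)) * (exp (lam * S t) * exp (- lam * x))))"
            by (simp add: Y_def mult_ac)
          also have "exp (lam * (x - S t)) * (exp (lam * S t) * exp (- lam * x)) = 1"
            by (simp add: algebra_simps flip: exp_add)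
          finally show ?thesis by simp
        qed
        have "A * W \<le> A * Q" using Y Q \<open>A * W = Y * Q\<close> by simp
        then have WQ: "W \<le> Q" using A(1) by simp
        have "A / (1 + e / 4) * Q \<le> Y * Q" using Y Q by (intro mult_right_mono) auto
        then have "A / (1 + e / 4) * Q \<le> A * W" by (simp only: \<open>A * W = Y * Q\<close>)
        then have "A * Q \<le> A * (W * (1 + e / 4))" using e by (simp add: field_simps)
        then have QW: "Q \<le> (1 + e / 4) * W" using A(1) by (simp add: mult.commute)
        have "u0 x \<le> (1 + e / 4) * Q" unfolding u0 using y Q by (intro mult_right_mono) auto
        also have "\<dots> \<le> (1 + e / 4) * ((1 + e / 4) * W)" using QW e by (intro mult_left_mono) auto
        also have "\<dots> = (1 + e / 2 + e * e / 16) * W" by (simp add: field_simps)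
        also have "\<dots> \<le> (1 + e) * W"
        proof (rule mult_right_mono)
          have "e * e \<le> e * 1" using e by (intro mult_left_mono) auto
          then show "1 + e / 2 + e * e / 16 \<le> 1 + e" using e by linarith
        qed (use W in simp)
        finally have up: "u0 x \<le> (1 + e) * W" .
        have "(1 - e) * W \<le> (1 - e / 4) * W" using e W by (intro mult_right_mono) auto
        also have "\<dots> \<le> (1 - e / 4) * Q" using WQ e by (intro mult_left_mono) auto
        also have "\<dots> \<le> u0 x" unfolding u0 using y Q by (intro mult_right_mono) auto
        finally have "\<bar>u0 x - W\<bar> \<le> e * W" using up by (simp add: abs_le_iff algebra_simps)
        also have "\<dots> \<le> (e + exp (\<omega> * t) * g1 + exp (\<omega> * t) * g2) * W"
          using W g by (intro mult_right_mono) auto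
        finally show ?thesis .
      qed
      then show "\<bar>u0 x - U (x - S t)\<bar> \<le>
        (e + exp (\<omega> * t) * exp (- \<alpha> * (x - del * (1 - e1) * t))
         + exp (\<omega> * t) * exp (\<alpha> * (x - del * (1 + e1) * t))) * U (x - S t)"
        by (simp add: W_def g1_def g2_def)
    qed
  qed
qed

text \<open>The initial ratio is fed into \<open>front_barrier\<close> with the current time as
  final time. All error terms except \<open>e * U\<close> then decay exponentially up to powers of
  \<open>t\<close>, even at distance \<open>\<kappa> * t\<close> behind the front.\<close>

lemma front_convergence:
  obtains sig where "\<And>\<epsilon>. 0 < \<epsilon> \<Longrightarrow> \<exists>\<kappa>>0. \<kappa> < c \<and> (\<forall>\<^sub>F t in at_top. \<forall>x.
    - \<kappa> * t \<le> x - c * t - (nu / lam * ln t + sig) \<longrightarrow>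
    \<bar>u t x - U (x - c * t - (nu / lam * ln t + sig))\<bar> \<le> \<epsilon>)"
proof -
  obtain A where A: "0 < A" "\<And>x. U x * exp (lam * x) \<le> A" "((\<lambda>x. U x * exp (lam * x)) \<longlongrightarrow> A) at_top"
    using front_tail by blast
  define sig where "sig = ln (a * del powr nu / A) / lam"
  have sig: "A * exp (lam * sig) = a * del powr nu"
    using A(1) a_pos del_pos lam_pos by (simp add: sig_def)
  define S where "S = (\<lambda>t. nu / lam * ln t + sig)"
  have "\<exists>\<kappa>>0. \<kappa> < c \<and> (\<forall>\<^sub>F t in at_top. \<forall>x. - \<kappa> * t \<le> x - c * t - S t \<longrightarrow>
    \<bar>u t x - U (x - c * t - S t)\<bar> \<le> \<epsilon>)" if eps: "0 < \<epsilon>" for \<epsilon>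
  proof -
    define e where "e = min 1 (\<epsilon> / 2)"
    have e: "0 < e" "e \<le> 1" "e \<le> \<epsilon> / 2" using eps by (auto simp: e_def)
    have "isCont (\<lambda>y. y powr nu) 1" by (intro continuous_intros) auto
    then have "\<forall>e>0. \<exists>d>0. \<forall>y. dist y 1 < d \<longrightarrow> dist (y powr nu) (1 powr nu) < e"
      by (simp only: continuous_at_eps_delta)
    then obtain d where d: "0 < d" "\<And>y. dist y 1 < d \<Longrightarrow> dist (y powr nu) (1 powr nu) < e / 4"
      using e(1) by (meson divide_pos_pos zero_less_numeral)
    \<comment> \<open>The first bound gives continuity of the power at 1, the second keeps
      \<open>e1 < 1\<close>, and the third ensures \<open>\<alpha> \<le> lam\<close>.\<close>
    define e1 where "e1 = min (d / 2) (min (1 / 2) (8 * lam / del))"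
    have e1: "0 < e1" "e1 \<le> 1 / 2" "e1 \<le> 8 * lam / del" "e1 < d"
      using d lam_pos del_pos by (auto simp: e1_def)
    have e1_powr: "\<bar>y powr nu - 1\<bar> \<le> e / 4" if "\<bar>y - 1\<bar> \<le> e1" for y
      using d(2)[of y] that e1(4) by (simp add: dist_real_def)
    \<comment> \<open>With these choices \<open>\<alpha> * \<alpha> = \<omega> = k / 8\<close> and
      \<open>\<alpha> * \<kappa> = k / 4\<close>. The exponential rates become
      \<open>- 3 / 4 * k + k / 4 = - k / 2\<close> for the decreasing exponential and
      \<open>- 5 / 8 * k\<close> for the increasing one.\<close>
    define \<alpha> where "\<alpha> = del * e1 / 8"
    define k where "k = \<alpha> * del * e1"
    define \<omega> where "\<omega> = k / 8"
    define \<kappa> where "\<kappa> = del * e1 / 4"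
    have al: "0 < \<alpha>" "\<alpha> \<le> lam" and k: "0 < k" and om: "0 < \<omega>" and kap: "0 < \<kappa>"
      using del_pos e1 by (auto simp: \<alpha>_def k_def \<omega>_def \<kappa>_def field_simps)
    have al2: "\<alpha> * \<alpha> = k / 8" by (simp add: k_def \<alpha>_def)
    have "del * e1 \<le> del * 1" using del_pos e1 by (intro mult_left_mono) auto
    then have "\<kappa> < c" using lam_pos del_pos unfolding \<kappa>_def c_del by linarith
    from tail_slope_small[of "\<alpha> / 2"] al obtain Z where Z: "\<And>z. Z \<le> z \<Longrightarrow> tail_slope z \<le> \<alpha> / 2 * U z"
      by (auto simp: eventually_at_top_linorder)
    define X1 where "X1 = (\<lambda>t. exp (- \<alpha> * S t - k / 2 * t))"
    define X2 where "X2 = (\<lambda>t. exp (\<alpha> * S t - 5 / 8 * k * t))"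
    have lim1: "(X1 \<longlongrightarrow> 0) at_top"
      using exp_log_minus_linear_tendsto_0(1)[of "k / 2" "- \<alpha> * nu / lam" "- \<alpha> * sig"] k
      unfolding X1_def S_def by (simp add: algebra_simps)
    have lim2: "(X2 \<longlongrightarrow> 0) at_top"
      using exp_log_minus_linear_tendsto_0(1)[of "5 / 8 * k" "\<alpha> * nu / lam" "\<alpha> * sig"] k
      unfolding X2_def S_def by (simp add: algebra_simps)
    have lim3: "((\<lambda>t. t * X2 t) \<longlongrightarrow> 0) at_top"
      using exp_log_minus_linear_tendsto_0(2)[of "5 / 8 * k" "\<alpha> * nu / lam" "\<alpha> * sig"] k
      unfolding X2_def S_def by (simp add: algebra_simps)
    define R where "R = (\<lambda>t. X1 t + (1 + A) * X2 t + 2 * lam * \<alpha> * exp (\<alpha> * Z) * (t * X2 t))"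
    have "(R \<longlongrightarrow> 0 + (1 + A) * 0 + 2 * lam * \<alpha> * exp (\<alpha> * Z) * 0) at_top"
      unfolding R_def by (intro tendsto_intros lim1 lim2 lim3)
    then have R: "\<forall>\<^sub>F t in at_top. R t < \<epsilon> / 2" using eps by (intro order_tendstoD(2)[where y = 0]) auto
    have init: "\<forall>\<^sub>F t in at_top. \<forall>x. \<bar>u0 x - U (x - S t)\<bar> \<le>
      (e + exp (\<omega> * t) * exp (- \<alpha> * (x - del * (1 - e1) * t))
         + exp (\<omega> * t) * exp (\<alpha> * (x - del * (1 + e1) * t))) * U (x - S t)"
      unfolding S_def using e1
      by (intro initial_ratio[OF A sig e(1,2) e1(1) _ e1_powr al(1) om]) auto
    have "\<forall>\<^sub>F t in at_top. \<forall>x. - \<kappa> * t \<le> x - c * t - S t \<longrightarrow>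
      \<bar>u t x - U (x - c * t - S t)\<bar> \<le> \<epsilon>"
      using R init eventually_ge_at_top[of 0]
    proof eventually_elim
      case (elim t)
      define E1 where "E1 = exp (\<omega> * t + \<alpha> * del * (1 - e1) * t)"
      define E2 where "E2 = exp (\<omega> * t - \<alpha> * del * (1 + e1) * t)"
      define E3 where "E3 = 2 * lam * \<alpha> * E2 * exp (\<alpha> * (Z + S t) + \<alpha> * (del + 2 * \<alpha>) * t)"
      have E3: "E3 = 2 * lam * \<alpha> * exp (\<alpha> * Z) * X2 t"
      proof -
        have "\<omega> * t - \<alpha> * del * (1 + e1) * t + (\<alpha> * (Z + S t) + \<alpha> * (del + 2 * \<alpha>) * t)
          = \<alpha> * Z + (\<alpha> * S t + (\<omega> - \<alpha> * del * e1 + 2 * (\<alpha> * \<alpha>)) * t)"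
          by (simp add: algebra_simps)
        also have "\<omega> - \<alpha> * del * e1 + 2 * (\<alpha> * \<alpha>) = - (5 / 8 * k)"
          unfolding al2 \<omega>_def k_def[symmetric] by simp
        finally have "E2 * exp (\<alpha> * (Z + S t) + \<alpha> * (del + 2 * \<alpha>) * t) = exp (\<alpha> * Z) * X2 t"
          by (simp add: E2_def X2_def flip: exp_add)
        then show ?thesis by (simp add: E3_def mult.assoc)
      qed
      show ?case
      proof (intro allI impI)
        fix x assume x: "- \<kappa> * t \<le> x - c * t - S t"
        define z where "z = x - c * t - S t"
        have bar: "\<bar>u t x - U (x - c * t - S t)\<bar> \<le>
          (e + E1 * exp (- \<alpha> * (x - (2 * lam + \<alpha>) * t)) + E2 * exp (\<alpha> * (x - (2 * lam - 2 * \<alpha>) * t)) + E3 * t)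
            * U (x - c * t - S t)"
        proof (rule front_barrier[where Z = Z])
          fix y
          have eqs: "exp (\<omega> * t) * exp (- \<alpha> * (y - del * (1 - e1) * t)) = E1 * exp (- \<alpha> * (y - (2 * lam + \<alpha>) * 0))"
            "exp (\<omega> * t) * exp (\<alpha> * (y - del * (1 + e1) * t)) = E2 * exp (\<alpha> * (y - (2 * lam - 2 * \<alpha>) * 0))"
            by (simp_all add: E1_def E2_def algebra_simps flip: exp_add)
          show "\<bar>u0 y - U (y - S t)\<bar> \<le> (e + E1 * exp (- \<alpha> * (y - (2 * lam + \<alpha>) * 0))
            + E2 * exp (\<alpha> * (y - (2 * lam - 2 * \<alpha>) * 0)) + E3 * 0) * U (y - S t)"
            using elim(2)[rule_format, of y] unfolding eqs by simp
        qed (use al elim e Z in \<open>auto simp: E1_def E2_def E3_def\<close>)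
        have T1: "E1 * exp (- \<alpha> * (x - (2 * lam + \<alpha>) * t)) \<le> X1 t"
        proof -
          have "\<omega> * t + \<alpha> * del * (1 - e1) * t + - \<alpha> * (x - (2 * lam + \<alpha>) * t)
            = - \<alpha> * S t - \<alpha> * z + (\<omega> - \<alpha> * del * e1 + \<alpha> * \<alpha>) * t"
            by (simp add: z_def c_del algebra_simps)
          also have "\<omega> - \<alpha> * del * e1 + \<alpha> * \<alpha> = - (3 / 4 * k)"
            unfolding al2 \<omega>_def k_def[symmetric] by simp
          also have "- \<alpha> * S t - \<alpha> * z + - (3 / 4 * k) * t \<le> - \<alpha> * S t - k / 2 * t"
          proof -
            have "\<alpha> * (- \<kappa> * t) \<le> \<alpha> * z" using x al by (intro mult_left_mono) (auto simp: z_def)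
            moreover have "\<alpha> * \<kappa> = k / 4" by (simp add: \<kappa>_def k_def)
            then have "\<alpha> * (- \<kappa> * t) = - (k / 4 * t)" by (simp flip: mult.assoc)
            ultimately show ?thesis by linarith
          qed
          finally show ?thesis unfolding E1_def X1_def exp_add[symmetric] by simp
        qed
        \<comment> \<open>The increasing exponential is controlled only together with
          \<open>U z\<close>, whose decay at rate \<open>lam \<ge> \<alpha>\<close> compensates for
          it.\<close>
        have T2: "E2 * exp (\<alpha> * (x - (2 * lam - 2 * \<alpha>) * t)) * U z \<le> (1 + A) * X2 t"
        proof -
          have "\<omega> * t - \<alpha> * del * (1 + e1) * t + \<alpha> * (x - (2 * lam - 2 * \<alpha>) * t)
            = \<alpha> * z + (\<alpha> * S t + (\<omega> - \<alpha> * del * e1 + 2 * (\<alpha> * \<alpha>)) * t)"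
            by (simp add: z_def c_del algebra_simps)
          also have "\<omega> - \<alpha> * del * e1 + 2 * (\<alpha> * \<alpha>) = - (5 / 8 * k)"
            unfolding al2 \<omega>_def k_def[symmetric] by simp
          finally have eq: "E2 * exp (\<alpha> * (x - (2 * lam - 2 * \<alpha>) * t)) = exp (\<alpha> * z) * X2 t"
            by (simp add: E2_def X2_def flip: exp_add)
          have "exp (\<alpha> * z) * U z \<le> 1 + A"
          proof (cases "0 \<le> z")
            case True
            have "exp (\<alpha> * z) * U z \<le> exp (lam * z) * U z"
              using True al mult_right_mono[OF al(2) True] U_pos[of z] by (intro mult_right_mono) auto
            also have "\<dots> \<le> A" using A(2)[of z] by (simp add: mult.commute)
            finally show ?thesis by simp
          next
            case False
            then have "exp (\<alpha> * z) * U z \<le> 1 * 1"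
              using al U_pos[of z] U_less_1[of z] by (intro mult_mono) (auto simp: mult_nonneg_nonpos)
            then show ?thesis using A(1) by simp
          qed
          then have "exp (\<alpha> * z) * U z * X2 t \<le> (1 + A) * X2 t"
            by (intro mult_right_mono) (auto simp: X2_def)
          then show ?thesis unfolding eq by (simp add: mult_ac)
        qed
        have Uz: "0 \<le> U z" "U z \<le> 1" using U_pos[of z] U_less_1[of z] by auto
        have "\<bar>u t x - U z\<bar> \<le> e * U z + E1 * exp (- \<alpha> * (x - (2 * lam + \<alpha>) * t)) * U z
            + E2 * exp (\<alpha> * (x - (2 * lam - 2 * \<alpha>) * t)) * U z + E3 * t * U z"
          using bar by (simp add: z_def[symmetric] distrib_right)
        also have "\<dots> \<le> e * 1 + X1 t * 1 + (1 + A) * X2 t + E3 * t * 1"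
        proof (intro add_mono T2)
          show "e * U z \<le> e * 1" using e Uz by (intro mult_left_mono) auto
          show "E1 * exp (- \<alpha> * (x - (2 * lam + \<alpha>) * t)) * U z \<le> X1 t * 1"
            using T1 Uz by (intro mult_mono) (auto simp: X1_def)
          have "0 \<le> E3 * t" using lam_pos al elim by (simp add: E3 X2_def)
          then show "E3 * t * U z \<le> E3 * t * 1" using Uz by (intro mult_left_mono) auto
        qed
        also have "\<dots> = e + R t" by (simp add: R_def E3 mult_ac)
        also have "\<dots> \<le> \<epsilon>" using e elim by simp
        finally show "\<bar>u t x - U (x - c * t - S t)\<bar> \<le> \<epsilon>" by (simp add: z_def)
      qed
    qed
    with kap \<open>\<kappa> < c\<close> show ?thesis by blast
  qed
  then show ?thesis using that[of sig] unfolding S_def by blast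
qed

text \<open>A ray slightly slower than the front keeps \<open>u \<ge> e\<close> in a window around
  it. The bumps left behind persist, positivity spreads to the left of the first one, and the
  uniform lower bound is lifted to \<open>b\<close>.\<close>

lemma interior_convergence:
  fixes sig \<kappa> b :: real
  assumes kap: "0 < \<kappa>" "\<kappa> < c" and b: "b < 1"
    and conv: "\<forall>\<^sub>F t in at_top. \<forall>x. - \<kappa> * t \<le> x - c * t - (nu / lam * ln t + sig) \<longrightarrow>
      \<bar>u t x - U (x - c * t - (nu / lam * ln t + sig))\<bar> \<le> 1 / 4"
  shows "\<forall>\<^sub>F t in at_top. \<forall>x. 0 \<le> x \<and> x \<le> (c - \<kappa> / 2) * t \<longrightarrow> b \<le> u t x"
proof -
  define S where "S = (\<lambda>t. nu / lam * ln t + sig)"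
  obtain M where M: "0 \<le> M" "\<And>s. 0 \<le> s \<Longrightarrow> s \<le> 1 \<Longrightarrow> fD 0 * s - M * s\<^sup>2 \<le> f s"
    using f_quadratic_lower by blast
  \<comment> \<open>Since \<open>om^2\<close> is only half of \<open>fD 0\<close>, the quadratic
    defect of \<open>f\<close> is affordable for small \<open>s\<close>.\<close>
  define om where "om = sqrt (fD 0 / 2)"
  have om: "0 < om" "om\<^sup>2 = fD 0 / 2" using fD_zero_pos by (simp_all add: om_def)
  define e where "e = min (1 / 4) (fD 0 / (2 * (M + 1)))"
  have e: "0 < e" "e \<le> 1 / 4" "e \<le> fD 0 / (2 * (M + 1))"
  proof -
    have "0 < fD 0 / (2 * (M + 1))" using fD_zero_pos M(1) by simp
    then show "0 < e" by (simp add: e_def)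
  qed (unfold e_def, rule min.cobounded1, rule min.cobounded2)
  have f_ge: "om\<^sup>2 * s \<le> f s" if s: "0 \<le> s" "s \<le> e" for s
  proof -
    have "(M + 1) * s \<le> (M + 1) * (fD 0 / (2 * (M + 1)))"
      using s e M(1) by (intro mult_left_mono) auto
    also have "\<dots> = fD 0 / 2" using M(1) by (simp add: field_simps)
    finally have "M * s \<le> fD 0 / 2" using s by (simp add: algebra_simps)
    then have "M * s * s \<le> fD 0 / 2 * s" using s by (intro mult_right_mono) auto
    then show ?thesis using M(2)[of s] s e unfolding om(2) by (simp add: power2_eq_square)
  qed
  define R where "R = pi / (2 * om)"
  \<comment> \<open>In the frame of the front this ray recedes like
    \<open>- \<kappa> / 4 * t\<close>: inside the zone of convergence, yet eventually behind the
    point where \<open>U\<close> exceeds 1/2.\<close>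
  define c2 where "c2 = c - \<kappa> / 4"
  have c2: "0 < c2" using kap by (simp add: c2_def)
  obtain Z where Z: "\<And>z. z \<le> Z \<Longrightarrow> 1 / 2 < U z"
    using order_tendstoD(1)[OF U_at_bot, of "1 / 2"] by (auto simp: eventually_at_bot_linorder)
  have "\<forall>\<^sub>F t in at_top. R \<le> 3 * \<kappa> / 4 * t - S t"
    unfolding S_def using linear_minus_log_at_top[of "3 * \<kappa> / 4" "nu / lam" sig] kap
    by (simp add: filterlim_at_top)
  moreover have "\<forall>\<^sub>F t in at_top. R - Z \<le> \<kappa> / 4 * t - (- (nu / lam) * ln t + - sig)"
    using linear_minus_log_at_top[of "\<kappa> / 4" "- (nu / lam)" "- sig"] kap
    by (simp add: filterlim_at_top)
  ultimately have "\<forall>\<^sub>F t in at_top. \<forall>x. \<bar>x - c2 * t\<bar> \<le> R \<longrightarrow> e \<le> u t x"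
    using conv
  proof eventually_elim
    case (elim t)
    show ?case
    proof (intro allI impI)
      fix x assume x: "\<bar>x - c2 * t\<bar> \<le> R"
      define z where "z = x - c * t - S t"
      have z: "z = (x - c2 * t) - \<kappa> / 4 * t - S t" by (simp add: z_def c2_def algebra_simps)
      have "- \<kappa> * t \<le> z" using x elim(1) unfolding z by linarith
      then have "\<bar>u t x - U z\<bar> \<le> 1 / 4" using elim(3) by (simp add: z_def S_def)
      moreover have "z \<le> Z" using x elim(2) unfolding z S_def by linarith
      then have "1 / 2 < U z" by (rule Z)
      ultimately show "e \<le> u t x" using e(2) by linarith
    qed
  qed
  then obtain T' where T': "\<And>t x. T' \<le> t \<Longrightarrow> \<bar>x - c2 * t\<bar> \<le> R \<Longrightarrow> e \<le> u t x"
    by (auto simp: eventually_at_top_linorder)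
  define T2 where "T2 = max 0 T'"
  have T2: "0 \<le> T2" "T' \<le> T2" by (auto simp: T2_def)
  have persist: "e \<le> u t (c2 * t0)" if "T2 \<le> t0" "t0 \<le> t" for t t0
    by (rule bump_persists[of t0 t om e]) (use that T2 T' om e f_ge in \<open>auto simp: R_def\<close>)
  define X1 where "X1 = c2 * T2"
  have X1: "0 \<le> X1" using c2 T2 by (simp add: X1_def)
  \<comment> \<open>The ray passes \<open>x\<close> at time \<open>x / c2\<close>, and the bump
    there persists afterwards.\<close>
  have right: "e \<le> u t x" if "X1 \<le> x" "x \<le> c2 * t" for t x
    using persist[of "x / c2" t] that c2 by (simp add: X1_def field_simps)
  \<comment> \<open>The target \<open>b\<close> may be small or negative; the maximum keeps it above
    the starting level \<open>e / 8\<close>.\<close>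
  define b' where "b' = max b (1 / 2)"
  have b': "e / 8 \<le> b'" "b' < 1" "b \<le> b'" using b e by (auto simp: b'_def)
  obtain L T where LT: "0 < L" "0 < T"
    "\<And>t0 x0. 0 \<le> t0 \<Longrightarrow> (\<And>t x. t0 \<le> t \<Longrightarrow> t \<le> t0 + T \<Longrightarrow> \<bar>x - x0\<bar> \<le> L \<Longrightarrow> e / 8 \<le> u t x) \<Longrightarrow>
      b' \<le> u (t0 + T) x0"
    using plateau_rises[OF _ b'(1,2)] e(1) by (metis divide_pos_pos zero_less_numeral)
  \<comment> \<open>Spreading reaches down to \<open>- L\<close>, so the whole window around any
    \<open>x \<ge> 0\<close> is covered.\<close>
  obtain t2 where t2: "T2 \<le> t2" "\<And>t x. t2 \<le> t \<Longrightarrow> X1 - (X1 + L) \<le> x \<Longrightarrow> x \<le> X1 \<Longrightarrow> e / 8 \<le> u t x"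
  proof (rule positivity_spreads_left[of T2 "X1 + L" e X1])
    show "e \<le> u t X1" if "T2 \<le> t" for t using persist[of T2 t] that by (simp add: X1_def)
  qed (use X1 LT T2 e in auto)
  show ?thesis
    \<comment> \<open>The second threshold keeps the right end of the window behind the ray already
      at time \<open>t - T\<close>.\<close>
    using eventually_ge_at_top[of "t2 + T"] eventually_ge_at_top[of "(L + c2 * T) / (\<kappa> / 4)"]
  proof eventually_elim
    case (elim t)
    show ?case
    proof (intro allI impI)
      fix x assume x: "0 \<le> x \<and> x \<le> (c - \<kappa> / 2) * t"
      have "b' \<le> u ((t - T) + T) x"
      proof (rule LT(3))
        show "0 \<le> t - T" using elim t2(1) T2 by simp
        fix s y assume s: "t - T \<le> s" "s \<le> t - T + T" "\<bar>y - x\<bar> \<le> L"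
        show "e / 8 \<le> u s y"
        proof (cases "y \<le> X1")
          case True
          then show ?thesis using t2(2)[of s y] s elim x by (simp add: abs_le_iff)
        next
          case False
          have "L + c2 * T \<le> \<kappa> / 4 * t" using elim(2) kap by (simp add: field_simps)
          moreover have "c2 * t = c * t - \<kappa> / 4 * t" "(c - \<kappa> / 2) * t = c * t - \<kappa> / 2 * t"
            by (simp_all add: c2_def algebra_simps)
          ultimately have "y \<le> c2 * (t - T)" using s(3) x unfolding right_diff_distrib by linarith
          also have "\<dots> \<le> c2 * s" using s c2 by (intro mult_left_mono) auto
          finally have "e \<le> u s y" using False by (intro right) auto
          then show ?thesis using e by simp
        qed
      qed
      then show "b \<le> u t x" using b'(3) by simp
    qed
  qed
qed

text \<open>Behind \<open>- \<kappa> * t\<close> both \<open>u\<close> and the front lie between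
  \<open>1 - \<epsilon>\<close> and 1; ahead of it \<open>front_convergence\<close> applies.\<close>

lemma uniform_convergence:
  obtains sig where "\<And>\<epsilon>. 0 < \<epsilon> \<Longrightarrow> \<forall>\<^sub>F t in at_top. \<forall>x\<ge>0.
    \<bar>u t x - U (x - c * t - nu / lam * ln t - sig)\<bar> \<le> \<epsilon>"
proof -
  obtain sig where sig: "\<And>\<epsilon>. 0 < \<epsilon> \<Longrightarrow> \<exists>\<kappa>>0. \<kappa> < c \<and> (\<forall>\<^sub>F t in at_top. \<forall>x.
    - \<kappa> * t \<le> x - c * t - (nu / lam * ln t + sig) \<longrightarrow>
    \<bar>u t x - U (x - c * t - (nu / lam * ln t + sig))\<bar> \<le> \<epsilon>)"
    using front_convergence by blast
  have "\<forall>\<^sub>F t in at_top. \<forall>x\<ge>0. \<bar>u t x - U (x - c * t - nu / lam * ln t - sig)\<bar> \<le> \<epsilon>"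
    if eps: "0 < \<epsilon>" for \<epsilon>
  proof -
    \<comment> \<open>The accuracy 1/4 is what \<open>interior_convergence\<close> needs to start
      its bumps.\<close>
    obtain \<kappa> where kap: "0 < \<kappa>" "\<kappa> < c" and conv: "\<forall>\<^sub>F t in at_top. \<forall>x.
      - \<kappa> * t \<le> x - c * t - (nu / lam * ln t + sig) \<longrightarrow>
      \<bar>u t x - U (x - c * t - (nu / lam * ln t + sig))\<bar> \<le> min \<epsilon> (1 / 4)"
      using sig[of "min \<epsilon> (1 / 4)"] eps by auto
    have inner: "\<forall>\<^sub>F t in at_top. \<forall>x. 0 \<le> x \<and> x \<le> (c - \<kappa> / 2) * t \<longrightarrow> 1 - \<epsilon> \<le> u t x"
      by (rule interior_convergence[OF kap, where sig = sig])
         (use eps in \<open>auto intro: eventually_mono[OF conv]\<close>)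
    obtain Z where Z: "\<And>z. z \<le> Z \<Longrightarrow> 1 - \<epsilon> < U z"
      using order_tendstoD(1)[OF U_at_bot, of "1 - \<epsilon>"] eps by (auto simp: eventually_at_bot_linorder)
    \<comment> \<open>Half of \<open>\<kappa> * t\<close> absorbs the logarithmic shift, so the zone
      behind the front lies in the range of \<open>inner\<close>.\<close>
    have ev1: "\<forall>\<^sub>F t in at_top. 0 \<le> \<kappa> / 2 * t - (nu / lam * ln t + sig)"
      using linear_minus_log_at_top[of "\<kappa> / 2" "nu / lam" sig] kap unfolding filterlim_at_top
      by (metis half_gt_zero)
    have ev2: "\<forall>\<^sub>F t in at_top. - Z / \<kappa> \<le> t" by (rule eventually_ge_at_top)
    show ?thesis using conv inner ev1 ev2 eventually_ge_at_top[of 0]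
    proof eventually_elim
      case (elim t)
      show ?case
      proof (intro allI impI)
        fix x :: real assume x: "0 \<le> x"
        define z where "z = x - c * t - (nu / lam * ln t + sig)"
        have "\<bar>u t x - U z\<bar> \<le> \<epsilon>"
        proof (cases "- \<kappa> * t \<le> z")
          case True
          then show ?thesis using elim(1) unfolding z_def by auto
        next
          case False
          have "- Z \<le> \<kappa> * t" using elim(4) kap by (simp add: field_simps)
          with False have "1 - \<epsilon> < U z" by (intro Z) simp
          moreover have "x \<le> (c - \<kappa> / 2) * t"
            using False elim(3) unfolding z_def left_diff_distrib by linarith
          then have "1 - \<epsilon> \<le> u t x" using elim(2) x by blast
          ultimately show ?thesis
            using u_range(2)[of t x] U_less_1[of z] elim(5) by linarith
        qed
        then show "\<bar>u t x - U (x - c * t - nu / lam * ln t - sig)\<bar> \<le> \<epsilon>"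
          by (simp add: z_def algebra_simps)
      qed
    qed
  qed
  then show ?thesis by (rule that)
qed

end

theorem theorem1p5:
  fixes f fD U u0 :: "real \<Rightarrow> real" and u :: "real \<Rightarrow> real \<Rightarrow> real"
    and lam c nu a :: real
  assumes hf: "kpp_nonlinearity f fD"
    and hlam: "0 < lam" "lam < sqrt (fD 0)"
    and hc: "c = lam + fD 0 / lam"
    and hU: "traveling_front f c U"
    and hu0_cont: "continuous_on UNIV u0"
    and hu0_range: "\<forall>x. 0 \<le> u0 x \<and> u0 x \<le> 1"
    and hu0_nz: "\<exists>x. u0 x \<noteq> 0"
    and ha: "0 < a"
    and hu0_tail: "eventually (\<lambda>x. u0 x = a * x powr nu * exp (- lam * x)) at_top"
    and hu: "classical_solution f u0 u"
  shows "\<exists>\<sigma>. ((\<lambda>t. SUP x\<in>{0..}. \<bar>u t x - U (x - c * t - nu / lam * ln t - \<sigma>)\<bar>)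
              \<longlongrightarrow> 0) at_top"
proof -
  interpret kpp_cauchy_tail f fD U lam c u0 u nu a
    by unfold_locales (use assms in auto)
  obtain sig where sig: "\<And>\<epsilon>. 0 < \<epsilon> \<Longrightarrow> \<forall>\<^sub>F t in at_top. \<forall>x\<ge>0.
    \<bar>u t x - U (x - c * t - nu / lam * ln t - sig)\<bar> \<le> \<epsilon>"
    using uniform_convergence by blast
  have "((\<lambda>t. SUP x\<in>{0..}. \<bar>u t x - U (x - c * t - nu / lam * ln t - sig)\<bar>) \<longlongrightarrow> 0) at_top"
  proof (rule tendstoI)
    fix \<epsilon> :: real assume eps: "0 < \<epsilon>"
    then have "\<forall>\<^sub>F t in at_top. \<forall>x\<ge>0.
      \<bar>u t x - U (x - c * t - nu / lam * ln t - sig)\<bar> \<le> \<epsilon> / 2" by (intro sig) simp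
    then show "\<forall>\<^sub>F t in at_top.
      dist (SUP x\<in>{0..}. \<bar>u t x - U (x - c * t - nu / lam * ln t - sig)\<bar>) 0 < \<epsilon>"
    proof eventually_elim
      case (elim t)
      define g where "g = (\<lambda>x. \<bar>u t x - U (x - c * t - nu / lam * ln t - sig)\<bar>)"
      have g: "g x \<le> \<epsilon> / 2" if "x \<in> {0..}" for x using elim that by (simp add: g_def)
      \<comment> \<open>A real supremum bounds its set from above only if the set is bounded above,
        so this precedes the estimate from below.\<close>
      have "bdd_above (g ` {0..})" using g by (intro bdd_aboveI2)
      then have "0 \<le> (SUP x\<in>{0..}. g x)"
        by (rule cSUP_upper2[of _ _ 0]) (auto simp: g_def)
      moreover have "(SUP x\<in>{0..}. g x) \<le> \<epsilon> / 2" by (rule cSUP_least) (use g in auto)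
      ultimately show ?case using eps by (simp add: g_def)
    qed
  qed
  then show ?thesis ..
qed

end
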